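(* Let $\varphi:\mathcal M\to\mathbb R$ be measurable, write $\varphi_\omega:=\varphi(\omega,\cdot)$, and suppose that $\int_{M_\omega}\varphi_\omega\,d\mu_\omega=0$ for $\mathbb P$-a.e. $\omega$, that $\varphi_\omega$ is Lipschitz for $\mathbb P$-a.e. $\omega$, and that $\omega\mapsto\|\varphi_\omega\|_{\mathrm{Lip}}$ belongs to $L^r(\Omega,\mathcal F,\mathbb P)$ for some $0<r\le\infty$. Suppose that the decay condition holds with $\mathcal I=\{s\}$, $s\ge2$, exponent $p>0$ and sequence $(a_n)=(a_{s,n})$ with $\sum_{n=1}^\infty a_n<+\infty$. Then for every $\delta>0$ there is $\bar K\in L^\varrho(\Omega,\mathcal F,\mathbb P)$, where $\frac1\varrho=\frac1p+\frac1r$, such that for $\mathbb P$-a.e. $\omega\in\Omega$ and every $n\in\mathbb N$, $$\|S_n^\omega\varphi\|_{L^s(\mu_\omega)}\le\bar K(\omega)\,n^{1/2+1/p+1/r+\delta},\qquad S_n^\omega\varphi:=\sum_{k=0}^{n-1}\varphi_{\sigma^k\omega}\circ T_\omega^k.$$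
   Context: Setting: $(\Omega,\mathcal F,\mathbb P,\sigma)$ is an ergodic probability-preserving system. $M$ is a metric space and $M_\omega\subset M$, $\omega\in\Omega$, are closed subsets such that $\mathcal M:=\{(\omega,x):\omega\in\Omega,\ x\in M_\omega\}\in\mathcal F\otimes\mathcal B(M)$. The maps $T_\omega:M_\omega\to M_{\sigma\omega}$ are such that $(\omega,x)\mapsto T_\omega(x)$ is measurable; $T_\omega^n:=T_{\sigma^{n-1}\omega}\circ\cdots\circ T_{\sigma\omega}\circ T_\omega$, $T_\omega^0=\mathrm{Id}$. $\mu_\omega$ are Borel probability measures on $M_\omega$ with $(T_\omega)_*\mu_\omega=\mu_{\sigma\omega}$ for $\mathbb P$-a.e. $\omega$, such that $\omega\mapsto\mu_\omega(\mathcal C_\omega)$ is measurable for every measurable $\mathcal C\subset\mathcal M$, where $\mathcal C_\omega=\{x\in M_\omega:(\omega,x)\in\mathcal C\}$. $L_\omega$ is the transfer operator of $T_\omega$ with respect to these measures: $\int_{M_\omega}g\cdot(f\circ T_\omega)\,d\mu_\omega=\int_{M_{\sigma\omega}}(L_\omega g)f\,d\mu_{\sigma\omega}$ for bounded measurable $g:M_\omega\to\mathbb R$, $f:M_{\sigma\omega}\to\mathbb R$; $L_\omega^n=L_{\sigma^{n-1}\omega}\circ\cdots\circ L_{\sigma\omega}\circ L_\omega$, $L_\omega^0=\mathrm{Id}$. $\|\cdot\|_{\mathrm{Lip}}$ is the usual Lipschitz norm (supremum norm plus Lipschitz constant) and $[g]_\omega:=g-\mu_\omega(g)$. Decay condition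 (with finite set $\mathcal I\subset(0,\infty)$, exponent $p>0$ and, for each $s\in\mathcal I$, a decreasing sequence $(a_{s,n})_{n\ge0}$ of positive numbers converging to $0$): there is a random variable $K\in L^p(\Omega,\mathcal F,\mathbb P)$ such that for $\mathbb P$-a.e. $\omega$, every $s\in\mathcal I$, all integers $0\le r'\le i\le j$ and all Lipschitz $g_1:M_{\sigma^{r'}\omega}\to\mathbb R$, $g_2:M_{\sigma^i\omega}\to\mathbb R$, $$\big\|\big[L_{\sigma^i\omega}^{j-i}\big(g_2\,L_{\sigma^{r'}\omega}^{i-r'}(g_1)\big)\big]_{\sigma^j\omega}\big\|_{L^s(\mu_{\sigma^j\omega})}\le K(\sigma^i\omega)\,a_{s,j-i}\,(1+\|g_1\|_{\mathrm{Lip}})(1+\|g_2\|_{\mathrm{Lip}}).$$ Convention: $1/\infty=0$. *)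

theory Defs
  imports "HOL-Probability.Probability"
begin

definition in_Lp :: "'a measure \<Rightarrow> ennreal \<Rightarrow> ('a \<Rightarrow> real) \<Rightarrow> bool" where
  "in_Lp M p f \<longleftrightarrow> f \<in> borel_measurable M \<and>
     (if p = \<infinity> then (\<exists>C. AE x in M. \<bar>f x\<bar> \<le> C)
      else integrable M (\<lambda>x. \<bar>f x\<bar> powr enn2real p))"

text \<open>The Bochner integral of a non-integrable function is \<open>0\<close>, so a bound on this norm is only
  meaningful together with \<open>in_Lp M (ennreal s) f\<close>; the two are always stated jointly below.\<close>

definition Lp_norm :: "'a measure \<Rightarrow> real \<Rightarrow> ('a \<Rightarrow> real) \<Rightarrow> real" where
  "Lp_norm M s f = (\<integral>x. \<bar>f x\<bar> powr s \<partial>M) powr (1 / s)"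

text \<open>The functions of finite Lipschitz norm. The real-valued \<open>lip_norm A f\<close> is the supremum norm plus
  the Lipschitz constant only for such \<open>f\<close> (and nonempty \<open>A\<close>).\<close>

definition bdd_lipschitz_on :: "'m::metric_space set \<Rightarrow> ('m \<Rightarrow> real) \<Rightarrow> bool" where
  "bdd_lipschitz_on A f \<longleftrightarrow> bounded (f ` A) \<and> (\<exists>C. C-lipschitz_on A f)"

definition lip_norm :: "'m::metric_space set \<Rightarrow> ('m \<Rightarrow> real) \<Rightarrow> real" where
  "lip_norm A f = (SUP x\<in>A. \<bar>f x\<bar>) + Inf {C. C-lipschitz_on A f}"

text \<open>\<open>cocycle \<sigma> A n \<omega>\<close> is the composition of \<open>A \<omega>\<close>, \<open>A (\<sigma> \<omega>)\<close>, \<open>\<dots>\<close>, \<open>A (\<sigma>\<^sup>n\<^sup>-\<^sup>1 \<omega>)\<close>, with \<open>A \<omega>\<close> applied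
  first. It is used for the maps \<open>T\<^sub>\<omega>\<close> and for their transfer operators.\<close>

primrec cocycle :: "('w \<Rightarrow> 'w) \<Rightarrow> ('w \<Rightarrow> 'c \<Rightarrow> 'c) \<Rightarrow> nat \<Rightarrow> 'w \<Rightarrow> 'c \<Rightarrow> 'c" where
  "cocycle \<sigma> A 0 \<omega> = id"
| "cocycle \<sigma> A (Suc n) \<omega> = A ((\<sigma> ^^ n) \<omega>) \<circ> cocycle \<sigma> A n \<omega>"

text \<open>Duality determines \<open>L g\<close> only up to null sets, so \<open>L\<close> acts on representatives and is an
  arbitrary choice of versions. Its domain consists of the essentially bounded functions rather than
  the bounded ones because a version of \<open>L g\<close> need not be bounded everywhere even if \<open>g\<close> is; this makes
  iterates well defined. If \<open>N\<close> is the image of \<open>M\<close> under \<open>T\<close>, both formulations describe the same operator.\<close>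

definition is_transfer_operator ::
    "'a measure \<Rightarrow> 'b measure \<Rightarrow> ('a \<Rightarrow> 'b) \<Rightarrow> (('a \<Rightarrow> real) \<Rightarrow> 'b \<Rightarrow> real) \<Rightarrow> bool" where
  "is_transfer_operator M N T L \<longleftrightarrow>
     (\<forall>g. in_Lp M \<infinity> g \<longrightarrow>
        in_Lp N \<infinity> (L g) \<and>
        (\<forall>f \<in> borel_measurable N. bounded (f ` space N) \<longrightarrow>
           (\<integral>x. g x * f (T x) \<partial>M) = (\<integral>y. L g y * f y \<partial>N)))"

locale ergodic_system = prob_space P for P :: "'w measure" +
  fixes \<sigma> :: "'w \<Rightarrow> 'w"
  assumes shift_measurable: "\<sigma> \<in> P \<rightarrow>\<^sub>M P"
    and shift_invariant: "distr P P \<sigma> = P"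
    and shift_ergodic: "\<And>A. A \<in> sets P \<Longrightarrow> \<sigma> -` A \<inter> space P = A \<Longrightarrow> prob A = 0 \<or> prob A = 1"

definition total_space :: "'w measure \<Rightarrow> ('w \<Rightarrow> 'm::metric_space set) \<Rightarrow> ('w \<times> 'm) measure" where
  "total_space P X = restrict_space (P \<Otimes>\<^sub>M borel) (Sigma (space P) X)"

text \<open>The fibre over \<open>\<omega>\<close> is \<open>X \<omega>\<close>; the values of \<open>T \<omega>\<close> and of functions on \<open>X \<omega>\<close> outside \<open>X \<omega>\<close> are
  irrelevant.\<close>

locale random_system = ergodic_system P \<sigma> for P :: "'w measure" and \<sigma> +
  fixes X :: "'w \<Rightarrow> 'm::metric_space set"
    and T :: "'w \<Rightarrow> 'm \<Rightarrow> 'm"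
    and \<mu> :: "'w \<Rightarrow> 'm measure"
    and L :: "'w \<Rightarrow> ('m \<Rightarrow> real) \<Rightarrow> 'm \<Rightarrow> real"
  assumes fibre_closed: "\<And>\<omega>. \<omega> \<in> space P \<Longrightarrow> closed (X \<omega>)"
    and total_sets: "Sigma (space P) X \<in> sets (P \<Otimes>\<^sub>M borel)"
    and T_into: "\<And>\<omega>. \<omega> \<in> space P \<Longrightarrow> T \<omega> \<in> X \<omega> \<rightarrow> X (\<sigma> \<omega>)"
    and T_measurable: "(\<lambda>(\<omega>, x). T \<omega> x) \<in> total_space P X \<rightarrow>\<^sub>M borel"
    and \<mu>_sets: "\<And>\<omega>. \<omega> \<in> space P \<Longrightarrow> sets (\<mu> \<omega>) = sets (restrict_space borel (X \<omega>))"
    and \<mu>_prob: "\<And>\<omega>. \<omega> \<in> space P \<Longrightarrow> prob_space (\<mu> \<omega>)"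
    and \<mu>_equivariant: "AE \<omega> in P. distr (\<mu> \<omega>) (\<mu> (\<sigma> \<omega>)) (T \<omega>) = \<mu> (\<sigma> \<omega>)"
    and \<mu>_measurable: "\<And>C. C \<in> sets (total_space P X) \<Longrightarrow>
           (\<lambda>\<omega>. measure (\<mu> \<omega>) {x \<in> X \<omega>. (\<omega>, x) \<in> C}) \<in> borel_measurable P"
    and L_transfer: "AE \<omega> in P. is_transfer_operator (\<mu> \<omega>) (\<mu> (\<sigma> \<omega>)) (T \<omega>) (L \<omega>)"

definition centered :: "'m measure \<Rightarrow> ('m \<Rightarrow> real) \<Rightarrow> 'm \<Rightarrow> real" where
  "centered M g x = g x - (\<integral>y. g y \<partial>M)"

definition decay_condition ::
    "'w measure \<Rightarrow> ('w \<Rightarrow> 'w) \<Rightarrow> ('w \<Rightarrow> 'm::metric_space set) \<Rightarrow> ('w \<Rightarrow> 'm measure) \<Rightarrow>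
     ('w \<Rightarrow> ('m \<Rightarrow> real) \<Rightarrow> 'm \<Rightarrow> real) \<Rightarrow> real set \<Rightarrow> ennreal \<Rightarrow> (real \<Rightarrow> nat \<Rightarrow> real) \<Rightarrow> bool" where
  "decay_condition P \<sigma> X \<mu> L I p a \<longleftrightarrow>
     finite I \<and> I \<subseteq> {0<..} \<and> p > 0 \<and>
     (\<forall>s\<in>I. (\<forall>n. a s n > 0) \<and> decseq (a s) \<and> a s \<longlonglongrightarrow> 0) \<and>
     (\<exists>K. in_Lp P p K \<and>
        (AE \<omega> in P. \<forall>s\<in>I. \<forall>r' i j g1 g2.
           r' \<le> i \<longrightarrow> i \<le> j \<longrightarrow>
           bdd_lipschitz_on (X ((\<sigma> ^^ r') \<omega>)) g1 \<longrightarrow>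
           bdd_lipschitz_on (X ((\<sigma> ^^ i) \<omega>)) g2 \<longrightarrow>
           (let h = centered (\<mu> ((\<sigma> ^^ j) \<omega>))
                      (cocycle \<sigma> L (j - i) ((\<sigma> ^^ i) \<omega>)
                        (\<lambda>x. g2 x * cocycle \<sigma> L (i - r') ((\<sigma> ^^ r') \<omega>) g1 x))
            in in_Lp (\<mu> ((\<sigma> ^^ j) \<omega>)) (ennreal s) h \<and>
               Lp_norm (\<mu> ((\<sigma> ^^ j) \<omega>)) s h \<le>
                 K ((\<sigma> ^^ i) \<omega>) * a s (j - i) *
                 (1 + lip_norm (X ((\<sigma> ^^ r') \<omega>)) g1) * (1 + lip_norm (X ((\<sigma> ^^ i) \<omega>)) g2))))"

definition birkhoff_sum ::
    "('w \<Rightarrow> 'w) \<Rightarrow> ('w \<Rightarrow> 'm \<Rightarrow> 'm) \<Rightarrow> ('w \<times> 'm \<Rightarrow> real) \<Rightarrow> nat \<Rightarrow> 'w \<Rightarrow> 'm \<Rightarrow> real" where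
  "birkhoff_sum \<sigma> T \<phi> n \<omega> x = (\<Sum>k<n. \<phi> ((\<sigma> ^^ k) \<omega>, cocycle \<sigma> T k \<omega> x))"

end

theory Submission
  imports Defs
begin

text \<open>
  The proof is a martingale approximation along almost every orbit of the base.

  Fix \<open>\<omega>\<close>, write \<open>\<phi>\<^sub>k\<close> for the observable in the fibre over \<open>\<sigma>\<^sup>k \<omega>\<close> and put
  \<open>h\<^sub>k = (\<Sum>j<k. L\<^sup>k\<^sup>-\<^sup>j \<phi>\<^sub>j)\<close>. Then \<open>h\<^sub>k\<^sub>+\<^sub>1\<close> is the image of \<open>\<phi>\<^sub>k + h\<^sub>k\<close> under the transfer operator, so
  \<open>m\<^sub>k = \<phi>\<^sub>k + h\<^sub>k - h\<^sub>k\<^sub>+\<^sub>1 \<circ> T\<close> is annihilated by that operator: by duality it is orthogonal to every function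
  of the form \<open>f \<circ> T\<close>. In other words the functions \<open>m\<^sub>k \<circ> T\<^sup>k\<close> form a reverse martingale difference
  sequence, and the Birkhoff sum of \<open>\<phi>\<close> equals the one of \<open>m\<close> plus the single term \<open>h\<^sub>n \<circ> T\<^sup>n\<close>.

  For \<open>s \<ge> 2\<close> such sequences obey a square root law in \<open>L\<^sup>s\<close>. In the second order expansion of
  \<open>\<bar>x + y\<bar> powr s\<close> (\<open>abs_powr_add_le_second_order\<close>) the linear term integrates to \<open>0\<close> by orthogonality,
  and the remaining terms are small enough for an induction on the number of summands
  (\<open>Lp_norm_add_le_orthogonal\<close>, \<open>reverse_martingale_moment\<close>). The decay condition bounds
  \<open>L\<^sup>k\<^sup>-\<^sup>j \<phi>\<^sub>j\<close> in \<open>L\<^sup>s\<close> by a constant times \<open>K (\<sigma>\<^sup>j \<omega>) a\<^sub>k\<^sub>-\<^sub>j (1 + \<Phi> (\<sigma>\<^sup>j \<omega>))\<close>. Since \<open>a\<close> is summable, \<open>h\<^sub>k\<close> and \<open>m\<^sub>k\<close> are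
  bounded in terms of the maximum of \<open>(1 + \<bar>K\<bar>) (1 + \<Phi>)\<close> over the first \<open>n\<close> points of the orbit
  (\<open>birkhoff_moment\<close>).

  It remains to control that maximum. A random variable in \<open>L\<^sup>p\<close> grows along orbits of a measure preserving
  map at most like \<open>n powr (1 / p + \<epsilon>)\<close>, with a prefactor that is again in \<open>L\<^sup>p\<close> (\<open>orbit_growth\<close>). Applied to
  \<open>K\<close> and to \<open>\<Phi>\<close> this yields the exponent \<open>1 / p + 1 / r + \<delta>\<close>, and the product of the two prefactors is in
  \<open>L\<^sup>\<rho>\<close> (\<open>in_Lp_mult\<close>).
\<close>

section \<open>Second order bounds for real powers\<close>

text \<open>Weighted arithmetic-geometric mean of \<open>u powr b\<close> and \<open>1\<close> with weights \<open>1 / b\<close> and \<open>1 - 1 / b\<close>.\<close>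

lemma powr_above_tangent_at_1:
  fixes u b :: real
  assumes "0 \<le> u" "1 \<le> b"
  shows "1 + b * (u - 1) \<le> u powr b"
proof (cases "u = 0")
  case False
  have "(u powr b) powr (1 / b) * 1 powr (1 - 1 / b) \<le> 1 / b * u powr b + (1 - 1 / b) * 1"
    by (rule Youngs_inequality_0) (use assms False in auto)
  then have "u \<le> 1 / b * u powr b + (1 - 1 / b)"
    using assms by (simp add: powr_powr)
  then have "b * u \<le> b * (1 / b * u powr b + (1 - 1 / b))"
    using assms by (intro mult_left_mono) auto
  also have "\<dots> = u powr b + b - 1"
    using assms by (simp add: algebra_simps)
  finally show ?thesis
    by (simp add: algebra_simps)
qed (use assms in simp)

text \<open>Convexity bounds the increment of \<open>u powr s\<close> between \<open>1\<close> and \<open>1 + t\<close> by \<open>t\<close> times the derivative at the far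
  end \<open>1 + t\<close>. The error term is therefore \<open>t\<close> times the increment of the derivative \<open>s u powr (s - 1)\<close>,
  and since \<open>s - 1 \<ge> 1\<close> the same tangent bounds apply to that increment.\<close>

lemma powr_second_order_at_1:
  fixes s t :: real
  assumes "2 \<le> s" and t: "\<bar>t\<bar> < 1"
  shows "(1 + t) powr s \<le> 1 + s * t + s * s * 2 powr s * t\<^sup>2"
proof -
  \<comment> \<open>the tangent at \<open>1 + t\<close>, obtained by applying the tangent bound at \<open>1\<close> to \<open>1 / (1 + t)\<close>\<close>
  have upper: "(1 + t) powr b - 1 \<le> b * (1 + t) powr (b - 1) * t" if "1 \<le> b" for b
  proof -
    have "1 + b * (1 / (1 + t) - 1) \<le> (1 / (1 + t)) powr b"
      by (rule powr_above_tangent_at_1) (use t that in auto)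
    then have "(1 + t) powr b * (1 + b * (1 / (1 + t) - 1)) \<le> (1 + t) powr b * (1 / (1 + t)) powr b"
      by (rule mult_left_mono) simp
    also have "\<dots> = 1"
      using t by (simp add: powr_divide)
    also have "(1 + t) powr b * (1 + b * (1 / (1 + t) - 1))
        = (1 + t) powr b - b * ((1 + t) powr b / (1 + t)) * t"
      using t by (simp add: field_simps)
    also have "(1 + t) powr b / (1 + t) = (1 + t) powr (b - 1)"
      using t by (simp add: powr_diff)
    finally show ?thesis by simp
  qed
  have derivative: "t * ((1 + t) powr (s - 1) - 1) \<le> s * 2 powr s * t\<^sup>2"
  proof (cases "0 \<le> t")
    case True
    have "(1 + t) powr (s - 1) - 1 \<le> (s - 1) * (1 + t) powr (s - 1 - 1) * t"
      using upper[of "s - 1"] assms by simp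
    also have "\<dots> \<le> s * 2 powr s * t"
    proof (intro mult_right_mono mult_mono)
      show "(1 + t) powr (s - 1 - 1) \<le> 2 powr s"
        using assms t True by (intro powr_mono_both) auto
    qed (use assms True in auto)
    finally have "t * ((1 + t) powr (s - 1) - 1) \<le> t * (s * 2 powr s * t)"
      using True by (rule mult_left_mono)
    then show ?thesis by (simp add: power2_eq_square mult_ac)
  next
    case False
    have "1 + (s - 1) * t \<le> (1 + t) powr (s - 1)"
      using powr_above_tangent_at_1[of "1 + t" "s - 1"] assms by simp
    then have "t * ((1 + t) powr (s - 1) - 1) \<le> t * ((s - 1) * t)"
      using False by (intro mult_left_mono_neg) auto
    also have "\<dots> = (s - 1) * 1 * t\<^sup>2"
      by (simp add: power2_eq_square)
    also have "\<dots> \<le> s * 2 powr s * t\<^sup>2"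
      using assms by (intro mult_right_mono mult_mono) (auto intro: ge_one_powr_ge_zero)
    finally show ?thesis .
  qed
  have "(1 + t) powr s - 1 - s * t \<le> s * (t * ((1 + t) powr (s - 1) - 1))"
    using upper[of s] assms by (simp add: algebra_simps)
  also have "\<dots> \<le> s * (s * 2 powr s * t\<^sup>2)"
    using derivative assms by (intro mult_left_mono) auto
  finally show ?thesis by (simp add: algebra_simps)
qed

text \<open>The linear term is kept exactly, because it is the one that vanishes after integration when
  \<open>y\<close> is orthogonal to the functions of \<open>x\<close>. If \<open>\<bar>y\<bar> < \<bar>x\<bar>\<close>, scaling by \<open>x\<close> reduces the claim to the
  expansion at \<open>1\<close>; otherwise all terms are comparable with \<open>\<bar>y\<bar> powr s\<close>.\<close>

lemma abs_powr_add_le_second_order: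
  fixes s x y :: real
  assumes "2 \<le> s"
  defines "C \<equiv> s * s * 2 powr s"
  shows "\<bar>x + y\<bar> powr s
    \<le> \<bar>x\<bar> powr s + s * (y * (sgn x * \<bar>x\<bar> powr (s - 1))) + C * (\<bar>x\<bar> powr (s - 2) * \<bar>y\<bar> powr 2 + \<bar>y\<bar> powr s)"
proof (cases "\<bar>y\<bar> < \<bar>x\<bar>")
  case True
  then have "x \<noteq> 0" by auto
  define t where "t = y / x"
  have t: "\<bar>t\<bar> < 1"
    using True \<open>x \<noteq> 0\<close> by (simp add: t_def abs_divide)
  have y: "y = t * x"
    using \<open>x \<noteq> 0\<close> by (simp add: t_def)
  have "\<bar>x + y\<bar> powr s = \<bar>x\<bar> powr s * (1 + t) powr s"
  proof -
    have "\<bar>x + y\<bar> = \<bar>x\<bar> * \<bar>1 + t\<bar>"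
      unfolding y by (simp add: abs_mult[symmetric] algebra_simps)
    then show ?thesis using t by (simp add: powr_mult)
  qed
  also have "\<dots> \<le> \<bar>x\<bar> powr s * (1 + s * t + C * t\<^sup>2)"
    unfolding C_def using powr_second_order_at_1[OF assms(1) t] by (intro mult_left_mono) auto
  also have "\<dots> = \<bar>x\<bar> powr s + s * (t * \<bar>x\<bar> powr s) + C * (\<bar>x\<bar> powr s * t\<^sup>2)"
    by (simp add: algebra_simps)
  also have "t * \<bar>x\<bar> powr s = y * (sgn x * \<bar>x\<bar> powr (s - 1))"
  proof -
    have "\<bar>x\<bar> powr s = \<bar>x\<bar> * \<bar>x\<bar> powr (s - 1)"
      using \<open>x \<noteq> 0\<close> by (simp add: powr_mult_base)
    then show ?thesis unfolding y by (simp add: abs_sgn mult_ac)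
  qed
  also have "\<bar>x\<bar> powr s * t\<^sup>2 = \<bar>x\<bar> powr (s - 2) * \<bar>y\<bar> powr 2"
  proof -
    have "\<bar>x\<bar> powr s = \<bar>x\<bar> powr (s - 2) * \<bar>x\<bar> powr 2"
      by (simp only: powr_add[symmetric]) simp
    then show ?thesis unfolding y by (simp add: power_mult_distrib mult_ac)
  qed
  also have "\<bar>x\<bar> powr s + s * (y * (sgn x * \<bar>x\<bar> powr (s - 1))) + C * (\<bar>x\<bar> powr (s - 2) * \<bar>y\<bar> powr 2)
      \<le> \<bar>x\<bar> powr s + s * (y * (sgn x * \<bar>x\<bar> powr (s - 1))) + C * (\<bar>x\<bar> powr (s - 2) * \<bar>y\<bar> powr 2 + \<bar>y\<bar> powr s)"
    using assms by (simp add: distrib_left)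
  finally show ?thesis .
next
  case False
  have "\<bar>x + y\<bar> powr s \<le> (2 * \<bar>y\<bar>) powr s"
    using False assms by (intro powr_mono2) auto
  also have "\<dots> = 2 powr s * \<bar>y\<bar> powr s"
    by (simp add: powr_mult)
  finally have 1: "\<bar>x + y\<bar> powr s \<le> 2 powr s * \<bar>y\<bar> powr s" .
  have "\<bar>y * (sgn x * \<bar>x\<bar> powr (s - 1))\<bar> \<le> \<bar>y\<bar> * \<bar>y\<bar> powr (s - 1)"
    unfolding abs_mult using False assms
    by (intro mult_left_mono) (auto simp: abs_sgn_eq intro!: powr_mono2)
  also have "\<dots> = \<bar>y\<bar> powr s"
    by (simp add: powr_mult_base)
  finally have "s * - (y * (sgn x * \<bar>x\<bar> powr (s - 1))) \<le> s * \<bar>y\<bar> powr s"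
    using assms by (intro mult_left_mono) auto
  moreover have "(2 powr s + s) * \<bar>y\<bar> powr s \<le> C * \<bar>y\<bar> powr s"
  proof (rule mult_right_mono)
    have "2 powr s + s \<le> 2 powr s * s + 2 powr s * s"
    proof (rule add_mono)
      show "2 powr s \<le> 2 powr s * s" using assms by simp
      have "1 * s \<le> 2 powr s * s"
        using assms by (intro mult_right_mono ge_one_powr_ge_zero) auto
      then show "s \<le> 2 powr s * s" by simp
    qed
    also have "\<dots> = 2 * (s * 2 powr s)" by simp
    also have "\<dots> \<le> s * (s * 2 powr s)"
      using assms by (intro mult_right_mono) auto
    finally show "2 powr s + s \<le> C" by (simp add: C_def mult_ac)
  qed simp
  moreover have "0 \<le> \<bar>x\<bar> powr s" "0 \<le> C * (\<bar>x\<bar> powr (s - 2) * \<bar>y\<bar> powr 2)"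
    using assms by auto
  ultimately show ?thesis
    using 1 by (simp add: distrib_left distrib_right del: powr_ge_zero)
qed

text \<open>The gain that absorbs the second order terms when a bound growing like \<open>t powr b\<close> is propagated from \<open>t\<close> to \<open>t + 1\<close>.\<close>

lemma powr_Suc_ge:
  fixes t b :: real
  assumes "0 < t" "1 \<le> b"
  shows "t powr b + b * t powr (b - 1) \<le> (t + 1) powr b"
proof -
  have "t powr b * (1 + b * ((1 + 1 / t) - 1)) \<le> t powr b * (1 + 1 / t) powr b"
    using assms by (intro mult_left_mono powr_above_tangent_at_1) auto
  also have "\<dots> = (t + 1) powr b"
    using assms by (simp add: powr_mult[symmetric] algebra_simps)
  finally show ?thesis
    using assms by (simp add: powr_diff algebra_simps)
qed

lemma powr_convex_combination:
  fixes u v c s :: real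
  assumes "0 \<le> u" "0 \<le> v" "0 < c" "c < 1" "1 \<le> s"
  shows "(c * u + (1 - c) * v) powr s \<le> c * u powr s + (1 - c) * v powr s"
proof -
  \<comment> \<open>the case where one of \<open>u\<close> and \<open>v\<close> is the boundary point \<open>0\<close> of the domain of convexity\<close>
  have zero: "(d * w) powr s \<le> d * w powr s" if "0 < d" "d < 1" "0 \<le> w" for d w :: real
    using that assms powr_le_one_le[of d s] by (simp add: powr_mult mult_right_mono)
  show ?thesis
  proof (cases "u = 0 \<or> v = 0")
    case True
    then show ?thesis using zero[of c u] zero[of "1 - c" v] assms by auto
  next
    case False
    then show ?thesis
      using convex_onD[OF powr_convex[OF assms(5)], of c v u] assms by (simp add: add.commute)
  qed
qed

section \<open>Essentially bounded functions and the \<open>L\<^sup>s\<close> norm\<close>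

text \<open>Transfer operators act on the essentially bounded functions. On a probability space these are closed
  under all operations below and are integrable together with all their powers, so no integrability
  question arises as long as one stays in this class.\<close>

abbreviation ess_bounded :: "'a measure \<Rightarrow> ('a \<Rightarrow> real) \<Rightarrow> bool" where
  "ess_bounded M f \<equiv> in_Lp M top f"

lemma ess_bounded_iff:
  "ess_bounded M f \<longleftrightarrow> f \<in> borel_measurable M \<and> (\<exists>C. AE x in M. \<bar>f x\<bar> \<le> C)"
  by (simp add: in_Lp_def)

lemma ess_boundedI:
  "f \<in> borel_measurable M \<Longrightarrow> AE x in M. \<bar>f x\<bar> \<le> C \<Longrightarrow> ess_bounded M f"
  by (auto simp: ess_bounded_iff)

lemma ess_bounded_measurable: "ess_bounded M f \<Longrightarrow> f \<in> borel_measurable M"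
  by (simp add: in_Lp_def)

lemma ess_bounded_const [simp]: "ess_bounded M (\<lambda>_. c)"
  by (auto simp: ess_bounded_iff)

lemma ess_bounded_add:
  assumes "ess_bounded M f" "ess_bounded M g"
  shows "ess_bounded M (\<lambda>x. f x + g x)"
proof -
  obtain C D where "AE x in M. \<bar>f x\<bar> \<le> C" "AE x in M. \<bar>g x\<bar> \<le> D"
    using assms by (auto simp: ess_bounded_iff)
  then have "AE x in M. \<bar>f x + g x\<bar> \<le> C + D"
    by eventually_elim linarith
  then show ?thesis
    using assms by (auto simp: ess_bounded_iff)
qed

lemma ess_bounded_mult:
  assumes "ess_bounded M f" "ess_bounded M g"
  shows "ess_bounded M (\<lambda>x. f x * g x)"
proof -
  obtain C D where "AE x in M. \<bar>f x\<bar> \<le> C" "AE x in M. \<bar>g x\<bar> \<le> D"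
    using assms by (auto simp: ess_bounded_iff)
  then have "AE x in M. \<bar>f x * g x\<bar> \<le> C * D"
    by eventually_elim (auto simp: abs_mult intro!: mult_mono intro: order_trans[OF abs_ge_zero])
  then show ?thesis
    using assms by (auto simp: ess_bounded_iff)
qed

lemma ess_bounded_cmult: "ess_bounded M f \<Longrightarrow> ess_bounded M (\<lambda>x. c * f x)"
  by (rule ess_bounded_mult) auto

lemma ess_bounded_diff:
  assumes "ess_bounded M f" "ess_bounded M g"
  shows "ess_bounded M (\<lambda>x. f x - g x)"
  using ess_bounded_add[OF assms(1) ess_bounded_cmult[OF assms(2), of "-1"]] by simp

lemma ess_bounded_sum:
  assumes "\<And>i. i \<in> J \<Longrightarrow> ess_bounded M (f i)"
  shows "ess_bounded M (\<lambda>x. \<Sum>i\<in>J. f i x)"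
  using assms by (induction J rule: infinite_finite_induct) (auto intro: ess_bounded_add)

lemma ess_bounded_abs_powr:
  assumes "ess_bounded M f" "0 \<le> q"
  shows "ess_bounded M (\<lambda>x. \<bar>f x\<bar> powr q)"
proof -
  obtain C where "AE x in M. \<bar>f x\<bar> \<le> C"
    using assms by (auto simp: ess_bounded_iff)
  then have "AE x in M. \<bar>\<bar>f x\<bar> powr q\<bar> \<le> C powr q"
    by eventually_elim (use assms in \<open>auto intro!: powr_mono2\<close>)
  then show ?thesis
    using assms by (auto simp: ess_bounded_iff)
qed

lemma ess_bounded_sgn:
  assumes "ess_bounded M f"
  shows "ess_bounded M (\<lambda>x. sgn (f x))"
proof (rule ess_boundedI)
  show "(\<lambda>x. sgn (f x)) \<in> borel_measurable M"
    using ess_bounded_measurable[OF assms] by simp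
  show "AE x in M. \<bar>sgn (f x)\<bar> \<le> 1"
    by (simp add: abs_sgn_eq)
qed

lemma ess_bounded_comp:
  assumes "ess_bounded N f" "T \<in> M \<rightarrow>\<^sub>M N" "distr M N T = N"
  shows "ess_bounded M (\<lambda>x. f (T x))"
proof -
  obtain C where "AE x in N. \<bar>f x\<bar> \<le> C"
    using assms by (auto simp: ess_bounded_iff)
  then have "AE x in M. \<bar>f (T x)\<bar> \<le> C"
    using AE_distrD[OF assms(2), of "\<lambda>x. \<bar>f x\<bar> \<le> C"] unfolding assms(3) by simp
  then show ?thesis
    using assms measurable_compose[OF assms(2)] by (auto simp: ess_bounded_iff)
qed

lemma (in finite_measure) integrable_if_ess_bounded:
  "ess_bounded M f \<Longrightarrow> integrable M f"
  unfolding ess_bounded_iff by (auto intro!: integrable_const_bound)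

lemma (in finite_measure) in_Lp_if_ess_bounded:
  assumes "ess_bounded M f" "0 \<le> q"
  shows "in_Lp M (ennreal q) f"
  using assms integrable_if_ess_bounded[OF ess_bounded_abs_powr[OF assms]]
  by (simp add: in_Lp_def)

lemma Lp_norm_nonneg [simp]: "0 \<le> Lp_norm M s f"
  by (simp add: Lp_norm_def)

lemma integral_eq_Lp_norm_powr:
  assumes "0 < s"
  shows "(\<integral>x. \<bar>f x\<bar> powr s \<partial>M) = Lp_norm M s f powr s"
  using assms by (simp add: Lp_norm_def powr_powr)

lemma Lp_norm_le_if_integral_le:
  assumes "(\<integral>x. \<bar>f x\<bar> powr s \<partial>M) \<le> c powr s" "0 < s" "0 \<le> c"
  shows "Lp_norm M s f \<le> c"
proof -
  have "Lp_norm M s f \<le> (c powr s) powr (1 / s)"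
    unfolding Lp_norm_def using assms by (intro powr_mono2) auto
  then show ?thesis using assms by (simp add: powr_powr)
qed

lemma Lp_norm_cong_AE:
  assumes "AE x in M. f x = g x" "f \<in> borel_measurable M" "g \<in> borel_measurable M"
  shows "Lp_norm M s f = Lp_norm M s g"
proof -
  have "(\<integral>x. \<bar>f x\<bar> powr s \<partial>M) = (\<integral>x. \<bar>g x\<bar> powr s \<partial>M)"
    by (rule integral_cong_AE) (use assms in auto)
  then show ?thesis by (simp add: Lp_norm_def)
qed

lemma Lp_norm_comp:
  assumes "T \<in> M \<rightarrow>\<^sub>M N" "distr M N T = N" "f \<in> borel_measurable N"
  shows "Lp_norm M s (\<lambda>x. f (T x)) = Lp_norm N s f"
proof -
  have "(\<integral>x. \<bar>f x\<bar> powr s \<partial>distr M N T) = (\<integral>x. \<bar>f (T x)\<bar> powr s \<partial>M)"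
    by (rule integral_distr) (use assms in auto)
  then show ?thesis using assms(2) by (simp add: Lp_norm_def)
qed

lemma (in prob_space) Lp_norm_le_bound:
  assumes "f \<in> borel_measurable M" "AE x in M. \<bar>f x\<bar> \<le> c" "0 < s" "0 \<le> c"
  shows "Lp_norm M s f \<le> c"
proof (rule Lp_norm_le_if_integral_le)
  have f: "ess_bounded M f" using assms by (auto simp: ess_bounded_iff)
  have "(\<integral>x. \<bar>f x\<bar> powr s \<partial>M) \<le> (\<integral>x. c powr s \<partial>M)"
  proof (rule integral_mono_AE)
    show "integrable M (\<lambda>x. \<bar>f x\<bar> powr s)"
      using f assms by (intro integrable_if_ess_bounded ess_bounded_abs_powr) auto
    show "AE x in M. \<bar>f x\<bar> powr s \<le> c powr s"
      using assms(2) by eventually_elim (use assms in \<open>auto intro!: powr_mono2\<close>)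
  qed simp
  then show "(\<integral>x. \<bar>f x\<bar> powr s \<partial>M) \<le> c powr s" by (simp add: prob_space)
qed (use assms in auto)

text \<open>Needed because the normalisation in the proof of the triangle inequality divides by both norms.\<close>

lemma (in prob_space) AE_zero_if_Lp_norm_zero:
  assumes "ess_bounded M f" "0 < s" "Lp_norm M s f = 0"
  shows "AE x in M. f x = 0"
proof -
  have "(\<integral>x. \<bar>f x\<bar> powr s \<partial>M) = 0"
    using assms by (simp add: integral_eq_Lp_norm_powr)
  then have "AE x in M. \<bar>f x\<bar> powr s = 0"
    by (subst (asm) integral_nonneg_eq_0_iff_AE)
      (use assms in \<open>auto intro!: integrable_if_ess_bounded ess_bounded_abs_powr\<close>)
  then show ?thesis by simp
qed

text \<open>Minkowski's inequality: dividing by \<open>a + b\<close>, where \<open>a\<close> and \<open>b\<close> are the two norms, exhibits \<open>f + g\<close> as a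
  convex combination of the normalised functions \<open>f / a\<close> and \<open>g / b\<close>.\<close>

lemma (in prob_space) Lp_norm_add_le:
  assumes f: "ess_bounded M f" and g: "ess_bounded M g" and s: "1 \<le> s"
  shows "Lp_norm M s (\<lambda>x. f x + g x) \<le> Lp_norm M s f + Lp_norm M s g"
proof -
  define a b where "a = Lp_norm M s f" and "b = Lp_norm M s g"
  have m [measurable]: "f \<in> borel_measurable M" "g \<in> borel_measurable M"
    using f g by (auto simp: ess_bounded_iff)
  consider "a = 0" | "b = 0" | "0 < a" "0 < b"
    using Lp_norm_nonneg[of M s] by (force simp: a_def b_def less_le)
  then show ?thesis
  proof cases
    case 1
    then have "AE x in M. f x = 0"
      using AE_zero_if_Lp_norm_zero[OF f, of s] s by (simp add: a_def)
    then have "AE x in M. f x + g x = g x" by simp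
    then show ?thesis using 1 by (subst Lp_norm_cong_AE[where g = g]) (auto simp: a_def)
  next
    case 2
    then have "AE x in M. g x = 0"
      using AE_zero_if_Lp_norm_zero[OF g, of s] s by (simp add: b_def)
    then have "AE x in M. f x + g x = f x" by simp
    then show ?thesis using 2 by (subst Lp_norm_cong_AE[where g = f]) (auto simp: b_def)
  next
    case 3
    define c where "c = a / (a + b)"
    have c: "0 < c" "c < 1" "1 - c = b / (a + b)"
      using 3 by (auto simp: c_def field_simps)
    have bound: "\<bar>f x + g x\<bar> powr s
        \<le> (a + b) powr s * (c * (\<bar>f x\<bar> powr s / a powr s) + (1 - c) * (\<bar>g x\<bar> powr s / b powr s))" for x
    proof -
      have "\<bar>f x + g x\<bar> powr s \<le> (\<bar>f x\<bar> + \<bar>g x\<bar>) powr s"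
        using s by (intro powr_mono2) auto
      also have "\<bar>f x\<bar> + \<bar>g x\<bar> = (a + b) * (c * (\<bar>f x\<bar> / a) + (1 - c) * (\<bar>g x\<bar> / b))"
      proof -
        have "(a + b) * (c * (\<bar>f x\<bar> / a) + (1 - c) * (\<bar>g x\<bar> / b))
            = ((a + b) * c / a) * \<bar>f x\<bar> + ((a + b) * (1 - c) / b) * \<bar>g x\<bar>"
          by (simp add: algebra_simps)
        also have "(a + b) * c / a = 1" using 3 by (simp add: c_def)
        also have "(a + b) * (1 - c) / b = 1" using 3 unfolding c(3) by simp
        finally show ?thesis by simp
      qed
      also have "\<dots> powr s \<le> (a + b) powr s * (c * (\<bar>f x\<bar> / a) powr s + (1 - c) * (\<bar>g x\<bar> / b) powr s)"
        unfolding powr_mult[of "a + b"]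
        using 3 c s by (intro mult_left_mono powr_convex_combination) auto
      finally show ?thesis by (simp add: powr_divide)
    qed
    have int: "integrable M (\<lambda>x. \<bar>f x\<bar> powr s)" "integrable M (\<lambda>x. \<bar>g x\<bar> powr s)"
        "integrable M (\<lambda>x. \<bar>f x + g x\<bar> powr s)"
      using f g s by (auto intro!: integrable_if_ess_bounded ess_bounded_abs_powr ess_bounded_add)
    have "(\<integral>x. \<bar>f x + g x\<bar> powr s \<partial>M)
        \<le> (\<integral>x. (a + b) powr s * (c * (\<bar>f x\<bar> powr s / a powr s) + (1 - c) * (\<bar>g x\<bar> powr s / b powr s)) \<partial>M)"
      using bound int by (intro integral_mono) auto
    also have "\<dots> = (a + b) powr s * (c * ((\<integral>x. \<bar>f x\<bar> powr s \<partial>M) / a powr s)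
        + (1 - c) * ((\<integral>x. \<bar>g x\<bar> powr s \<partial>M) / b powr s))"
      using int by simp
    also have "\<dots> = (a + b) powr s"
      using 3 s by (simp add: integral_eq_Lp_norm_powr a_def b_def)
    finally show ?thesis
      using 3 s by (intro Lp_norm_le_if_integral_le) (auto simp: a_def b_def)
  qed
qed

lemma Lp_norm_uminus: "Lp_norm M s (\<lambda>x. - f x) = Lp_norm M s f"
  by (simp add: Lp_norm_def)

lemma Lp_norm_zero [simp]: "Lp_norm M s (\<lambda>x. 0) = 0"
  by (simp add: Lp_norm_def)

lemma (in prob_space) Lp_norm_diff_le:
  assumes "ess_bounded M f" "ess_bounded M g" "1 \<le> s"
  shows "Lp_norm M s (\<lambda>x. f x - g x) \<le> Lp_norm M s f + Lp_norm M s g"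
  using Lp_norm_add_le[OF assms(1) ess_bounded_cmult[OF assms(2), of "-1"] assms(3)]
  by (simp add: Lp_norm_uminus)

lemma (in prob_space) Lp_norm_sum_le:
  assumes "finite J" "\<And>i. i \<in> J \<Longrightarrow> ess_bounded M (f i)" "1 \<le> s"
  shows "Lp_norm M s (\<lambda>x. \<Sum>i\<in>J. f i x) \<le> (\<Sum>i\<in>J. Lp_norm M s (f i))"
  using assms
proof (induction J)
  case (insert j J)
  have "Lp_norm M s (\<lambda>x. f j x + (\<Sum>i\<in>J. f i x)) \<le> Lp_norm M s (f j) + Lp_norm M s (\<lambda>x. \<Sum>i\<in>J. f i x)"
    using insert by (intro Lp_norm_add_le ess_bounded_sum) auto
  then show ?case using insert by fastforce
qed simp

section \<open>Reverse martingales along a chain of transfer operators\<close>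

text \<open>The pointwise second order expansion is integrated; its linear term is the vanishing integral.
  After normalising by the bounds \<open>\<alpha>\<close> and \<open>\<beta>\<close>, the mixed term is at most
  the larger of two \<open>s\<close>-th powers, hence at most their sum.\<close>

lemma (in prob_space) integral_abs_add_powr_le_orthogonal:
  assumes x: "ess_bounded M x" and y: "ess_bounded M y" and s: "2 \<le> s"
    and orthogonal: "(\<integral>\<omega>. y \<omega> * (sgn (x \<omega>) * \<bar>x \<omega>\<bar> powr (s - 1)) \<partial>M) = 0"
    and \<alpha>: "Lp_norm M s x \<le> \<alpha>" "0 < \<alpha>" and \<beta>: "Lp_norm M s y \<le> \<beta>" "0 < \<beta>"
  shows "(\<integral>\<omega>. \<bar>x \<omega> + y \<omega>\<bar> powr s \<partial>M)
    \<le> \<alpha> powr s + s * s * 2 powr s * (2 * \<alpha> powr (s - 2) * \<beta> powr 2 + \<beta> powr s)"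
proof -
  define C where "C = s * s * 2 powr s"
  have C: "0 \<le> C" using s by (simp add: C_def)
  have mixed: "u powr (s - 2) * v powr 2 \<le> u powr s + v powr s" if "0 \<le> u" "0 \<le> v" for u v :: real
  proof -
    have "u powr (s - 2) * v powr 2 \<le> max u v powr (s - 2) * max u v powr 2"
      using that s by (intro mult_mono powr_mono2) auto
    also have "\<dots> = max u v powr s"
      by (simp only: powr_add[symmetric]) simp
    also have "\<dots> \<le> u powr s + v powr s"
      by (auto simp: max_def)
    finally show ?thesis .
  qed
  have cross: "\<bar>x \<omega>\<bar> powr (s - 2) * \<bar>y \<omega>\<bar> powr 2
      \<le> \<alpha> powr (s - 2) * \<beta> powr 2 * (\<bar>x \<omega>\<bar> powr s / \<alpha> powr s + \<bar>y \<omega>\<bar> powr s / \<beta> powr s)" for \<omega>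
  proof -
    have "\<bar>x \<omega>\<bar> powr (s - 2) * \<bar>y \<omega>\<bar> powr 2
        = \<alpha> powr (s - 2) * \<beta> powr 2 * ((\<bar>x \<omega>\<bar> / \<alpha>) powr (s - 2) * (\<bar>y \<omega>\<bar> / \<beta>) powr 2)"
      using \<alpha> \<beta> by (simp add: powr_divide power_divide)
    also have "\<dots> \<le> \<alpha> powr (s - 2) * \<beta> powr 2 * ((\<bar>x \<omega>\<bar> / \<alpha>) powr s + (\<bar>y \<omega>\<bar> / \<beta>) powr s)"
      using \<alpha> \<beta> by (intro mult_left_mono mixed) auto
    finally show ?thesis using \<alpha> \<beta> by (simp add: powr_divide)
  qed
  have pointwise: "\<bar>x \<omega> + y \<omega>\<bar> powr s
      \<le> \<bar>x \<omega>\<bar> powr s + s * (y \<omega> * (sgn (x \<omega>) * \<bar>x \<omega>\<bar> powr (s - 1)))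
        + C * (\<alpha> powr (s - 2) * \<beta> powr 2 * (\<bar>x \<omega>\<bar> powr s / \<alpha> powr s + \<bar>y \<omega>\<bar> powr s / \<beta> powr s)
            + \<bar>y \<omega>\<bar> powr s)" for \<omega>
    by (rule order_trans[OF abs_powr_add_le_second_order[OF s, folded C_def]])
      (use cross C in \<open>auto intro!: mult_left_mono\<close>)
  have X: "(\<integral>\<omega>. \<bar>x \<omega>\<bar> powr s \<partial>M) \<le> \<alpha> powr s" and Y: "(\<integral>\<omega>. \<bar>y \<omega>\<bar> powr s \<partial>M) \<le> \<beta> powr s"
    using \<alpha> \<beta> s by (auto simp: integral_eq_Lp_norm_powr intro!: powr_mono2)
  have int: "integrable M (\<lambda>\<omega>. \<bar>x \<omega>\<bar> powr s)" "integrable M (\<lambda>\<omega>. \<bar>y \<omega>\<bar> powr s)"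
      "integrable M (\<lambda>\<omega>. y \<omega> * (sgn (x \<omega>) * \<bar>x \<omega>\<bar> powr (s - 1)))"
      "integrable M (\<lambda>\<omega>. \<bar>x \<omega> + y \<omega>\<bar> powr s)"
    using x y s by (auto intro!: integrable_if_ess_bounded ess_bounded_abs_powr ess_bounded_add
        ess_bounded_mult ess_bounded_sgn)
  have "(\<integral>\<omega>. \<bar>x \<omega> + y \<omega>\<bar> powr s \<partial>M)
      \<le> (\<integral>\<omega>. \<bar>x \<omega>\<bar> powr s + s * (y \<omega> * (sgn (x \<omega>) * \<bar>x \<omega>\<bar> powr (s - 1)))
        + C * (\<alpha> powr (s - 2) * \<beta> powr 2 * (\<bar>x \<omega>\<bar> powr s / \<alpha> powr s + \<bar>y \<omega>\<bar> powr s / \<beta> powr s)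
            + \<bar>y \<omega>\<bar> powr s) \<partial>M)"
    using int pointwise by (intro integral_mono) auto
  also have "\<dots> = (\<integral>\<omega>. \<bar>x \<omega>\<bar> powr s \<partial>M)
      + C * (\<alpha> powr (s - 2) * \<beta> powr 2 * ((\<integral>\<omega>. \<bar>x \<omega>\<bar> powr s \<partial>M) / \<alpha> powr s
          + (\<integral>\<omega>. \<bar>y \<omega>\<bar> powr s \<partial>M) / \<beta> powr s) + (\<integral>\<omega>. \<bar>y \<omega>\<bar> powr s \<partial>M))"
    using int orthogonal by simp
  also have "\<dots> \<le> \<alpha> powr s + C * (\<alpha> powr (s - 2) * \<beta> powr 2 * (1 + 1) + \<beta> powr s)"
    using X Y C \<alpha> \<beta> by (intro add_mono mult_left_mono mult_nonneg_nonneg) (auto simp: divide_le_eq_1)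
  finally show ?thesis by (simp add: C_def mult_ac)
qed

text \<open>With \<open>C = s * s * 2 powr s\<close>, the constant of the second order expansion, the value \<open>1 + 3 * C\<close> is at
  least \<open>1\<close> and its square dominates \<open>3 * C\<close>; both are used to close the induction on the number of
  summands.\<close>

definition moment_const :: "real \<Rightarrow> real" where
  "moment_const s = 1 + 3 * (s * s * 2 powr s)"

lemma moment_const_ge_1: "1 \<le> moment_const s"
  by (simp add: moment_const_def)

text \<open>One step of the square root law: adding an orthogonal increment of norm at most \<open>\<beta>\<close> raises
  \<open>t\<close> to \<open>t + 1\<close>. The excess in \<open>s\<close>-th powers is of order \<open>t powr (s / 2 - 1)\<close>, which is also the order
  of the gap between \<open>(t + 1) powr (s / 2)\<close> and \<open>t powr (s / 2)\<close>.\<close>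

lemma (in prob_space) Lp_norm_add_le_orthogonal:
  assumes x: "ess_bounded M x" and y: "ess_bounded M y" and s: "2 \<le> s"
    and orthogonal: "(\<integral>\<omega>. y \<omega> * (sgn (x \<omega>) * \<bar>x \<omega>\<bar> powr (s - 1)) \<partial>M) = 0"
    and "0 < \<beta>" "1 \<le> t"
    and norm_x: "Lp_norm M s x \<le> moment_const s * sqrt t * \<beta>" and norm_y: "Lp_norm M s y \<le> \<beta>"
  shows "Lp_norm M s (\<lambda>\<omega>. x \<omega> + y \<omega>) \<le> moment_const s * sqrt (t + 1) * \<beta>"
proof (rule Lp_norm_le_if_integral_le)
  define C D where "C = s * s * 2 powr s" and "D = moment_const s"
  have C: "0 \<le> C" using s by (simp add: C_def)
  have D: "D = 1 + 3 * C" "1 \<le> D" using C by (auto simp: D_def C_def moment_const_def)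
  have expand: "(D * sqrt u * \<beta>) powr q = D powr q * u powr (q / 2) * \<beta> powr q" if "0 \<le> u" for u q
    using that by (simp add: powr_mult powr_half_sqrt[symmetric] powr_powr)
  have "(\<integral>\<omega>. \<bar>x \<omega> + y \<omega>\<bar> powr s \<partial>M)
      \<le> (D * sqrt t * \<beta>) powr s + C * (2 * (D * sqrt t * \<beta>) powr (s - 2) * \<beta> powr 2 + \<beta> powr s)"
    unfolding C_def
    by (rule integral_abs_add_powr_le_orthogonal) (use assms D in \<open>auto simp: D_def\<close>)
  also have "\<dots> = \<beta> powr s * (D powr s * t powr (s / 2)
      + C * (2 * (D powr (s - 2) * t powr (s / 2 - 1)) + 1))"
  proof -
    have "\<beta> powr s = \<beta> powr (s - 2) * \<beta> powr 2"
      by (simp only: powr_add[symmetric]) simp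
    moreover have "(s - 2) / 2 = s / 2 - 1" by simp
    moreover have "0 \<le> t" using \<open>1 \<le> t\<close> by simp
    ultimately show ?thesis
      unfolding expand[OF \<open>0 \<le> t\<close>] by (simp only: distrib_left mult.commute mult.left_commute)
  qed
  also have "\<dots> \<le> \<beta> powr s * (D powr s * (t + 1) powr (s / 2))"
  proof (rule mult_left_mono)
    have one: "1 \<le> D powr (s - 2) * t powr (s / 2 - 1)"
      using D s \<open>1 \<le> t\<close> mult_mono[of 1 "D powr (s - 2)" 1 "t powr (s / 2 - 1)"]
      by (simp add: ge_one_powr_ge_zero)
    have "C * (2 * (D powr (s - 2) * t powr (s / 2 - 1)) + 1)
        \<le> C * (3 * (D powr (s - 2) * t powr (s / 2 - 1)))"
      using one C by (intro mult_left_mono) auto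
    also have "\<dots> = (3 * C) * (D powr (s - 2) * t powr (s / 2 - 1))" by simp
    also have "\<dots> \<le> D powr 2 * (D powr (s - 2) * t powr (s / 2 - 1))"
    proof (rule mult_right_mono)
      have "3 * C \<le> D" using D by simp
      also have "\<dots> \<le> D powr 2" using D by (simp add: power2_eq_square)
      finally show "3 * C \<le> D powr 2" .
    qed simp
    also have "\<dots> = D powr s * t powr (s / 2 - 1)"
      by (simp only: mult.assoc[symmetric] powr_add[symmetric]) simp
    also have "\<dots> \<le> D powr s * (s / 2 * t powr (s / 2 - 1))"
    proof (rule mult_left_mono)
      show "t powr (s / 2 - 1) \<le> s / 2 * t powr (s / 2 - 1)"
        using s mult_right_mono[of 1 "s / 2" "t powr (s / 2 - 1)"] by simp
    qed simp
    finally have "D powr s * t powr (s / 2) + C * (2 * (D powr (s - 2) * t powr (s / 2 - 1)) + 1)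
        \<le> D powr s * (t powr (s / 2) + s / 2 * t powr (s / 2 - 1))"
      by (simp add: distrib_left)
    also have "\<dots> \<le> D powr s * (t + 1) powr (s / 2)"
      using powr_Suc_ge[of t "s / 2"] \<open>1 \<le> t\<close> s by (intro mult_left_mono) auto
    finally show "D powr s * t powr (s / 2) + C * (2 * (D powr (s - 2) * t powr (s / 2 - 1)) + 1)
        \<le> D powr s * (t + 1) powr (s / 2)" .
  qed simp
  also have "\<dots> = (D * sqrt (t + 1) * \<beta>) powr s"
    by (subst expand) (use \<open>1 \<le> t\<close> in \<open>auto simp: mult_ac\<close>)
  finally show "(\<integral>\<omega>. \<bar>x \<omega> + y \<omega>\<bar> powr s \<partial>M) \<le> (moment_const s * sqrt (t + 1) * \<beta>) powr s"
    by (simp add: D_def)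
qed (use assms moment_const_ge_1[of s] in auto)

lemma transfer_operator_ess_bounded:
  "is_transfer_operator M N T L \<Longrightarrow> ess_bounded M g \<Longrightarrow> ess_bounded N (L g)"
  by (simp add: is_transfer_operator_def)

text \<open>Duality for essentially bounded test functions: truncation makes them bounded and changes them on a null set only.\<close>

lemma transfer_operator_duality:
  assumes L: "is_transfer_operator M N T L" and T: "T \<in> M \<rightarrow>\<^sub>M N" "distr M N T = N"
    and g: "ess_bounded M g" and f: "ess_bounded N f"
  shows "(\<integral>x. g x * f (T x) \<partial>M) = (\<integral>y. L g y * f y \<partial>N)"
proof -
  obtain C where C: "AE y in N. \<bar>f y\<bar> \<le> C"
    using f by (auto simp: ess_bounded_iff)
  define c where "c y = max (- \<bar>C\<bar>) (min \<bar>C\<bar> (f y))" for y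
  have f_meas [measurable]: "f \<in> borel_measurable N" and g_meas [measurable]: "g \<in> borel_measurable M"
      and Lg_meas [measurable]: "L g \<in> borel_measurable N"
    using f g transfer_operator_ess_bounded[OF L g] by (auto simp: ess_bounded_iff)
  note T(1)[measurable]
  have c_meas [measurable]: "c \<in> borel_measurable N"
    unfolding c_def by measurable
  have "\<bar>c y\<bar> \<le> \<bar>C\<bar>" for y
    by (auto simp: c_def)
  then have c_bounded: "bounded (c ` space N)"
    by (auto simp: bounded_iff)
  have c_eq: "AE y in N. c y = f y"
    using C by eventually_elim (auto simp: c_def)
  then have "AE x in M. c (T x) = f (T x)"
    using AE_distrD[OF T(1), of "\<lambda>y. c y = f y"] unfolding T(2) by simp
  then have "(\<integral>x. g x * f (T x) \<partial>M) = (\<integral>x. g x * c (T x) \<partial>M)"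
    by (intro integral_cong_AE) auto
  also have "\<dots> = (\<integral>y. L g y * c y \<partial>N)"
    using L g c_bounded c_meas by (simp add: is_transfer_operator_def)
  also have "\<dots> = (\<integral>y. L g y * f y \<partial>N)"
    using c_eq by (intro integral_cong_AE) auto
  finally show ?thesis .
qed

lemma cocycle_Suc_first: "cocycle \<sigma> A (Suc n) \<omega> x = cocycle \<sigma> A n (\<sigma> \<omega>) (A \<omega> x)"
  by (induction n) (simp_all add: funpow_swap1)

text \<open>The system along a single orbit: the base has become the successor map on the natural numbers, and
  \<open>cocycle Suc T n k\<close> is the composition of \<open>n\<close> maps starting in the fibre \<open>k\<close>.\<close>

locale transfer_chain =
  fixes N :: "nat \<Rightarrow> 'a measure" and T :: "nat \<Rightarrow> 'a \<Rightarrow> 'a"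
    and L :: "nat \<Rightarrow> ('a \<Rightarrow> real) \<Rightarrow> 'a \<Rightarrow> real"
  assumes prob: "prob_space (N k)"
    and T_meas: "T k \<in> N k \<rightarrow>\<^sub>M N (Suc k)"
    and T_distr: "distr (N k) (N (Suc k)) (T k) = N (Suc k)"
    and transfer: "is_transfer_operator (N k) (N (Suc k)) (T k) (L k)"
begin

lemma orbit_meas: "cocycle Suc T n k \<in> N k \<rightarrow>\<^sub>M N (n + k)"
proof (induction n)
  case (Suc n)
  then show ?case using measurable_comp[OF Suc T_meas] by (simp add: comp_def)
qed (simp add: id_def)

lemma orbit_distr: "distr (N k) (N (n + k)) (cocycle Suc T n k) = N (n + k)"
proof (induction n)
  case 0
  show ?case using distr_id by (simp add: id_def)
next
  case (Suc n)
  have "distr (N k) (N (Suc n + k)) (cocycle Suc T (Suc n) k)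
      = distr (distr (N k) (N (n + k)) (cocycle Suc T n k)) (N (Suc (n + k))) (T (n + k))"
    using distr_distr[OF T_meas orbit_meas] by simp
  also have "\<dots> = N (Suc (n + k))"
    unfolding Suc by (rule T_distr)
  finally show ?case by (simp add: comp_def)
qed

lemma iterate_ess_bounded:
  "ess_bounded (N k) g \<Longrightarrow> ess_bounded (N (n + k)) (cocycle Suc L n k g)"
  by (induction n) (auto intro: transfer_operator_ess_bounded[OF transfer])

lemma iterate_integral:
  assumes "ess_bounded (N k) g"
  shows "(\<integral>x. cocycle Suc L n k g x \<partial>N (n + k)) = (\<integral>x. g x \<partial>N k)"
proof (induction n)
  case (Suc n)
  have "(\<integral>x. cocycle Suc L n k g x * 1 \<partial>N (n + k)) = (\<integral>x. L (n + k) (cocycle Suc L n k g) x * 1 \<partial>N (Suc (n + k)))"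
    by (rule transfer_operator_duality[OF transfer T_meas T_distr iterate_ess_bounded[OF assms] ess_bounded_const])
  then show ?case using Suc by simp
qed simp

text \<open>Peeling off the first summand leaves a function of \<open>T k x\<close>, to which \<open>m k\<close> is orthogonal. Induction
  therefore moves along the chain, with the remaining sum as a function on the next fibre. The bound has \<open>n + 1\<close> instead
  of \<open>n\<close> under the root so that it is positive at the start of the induction.\<close>

lemma reverse_martingale_moment:
  assumes m: "\<And>k. ess_bounded (N k) (m k)" and s: "2 \<le> s" and "0 < \<beta>"
    and orthogonal: "\<And>k f. ess_bounded (N (Suc k)) f \<Longrightarrow> (\<integral>x. m k x * f (T k x) \<partial>N k) = 0"
    and norm: "\<And>j. j < n \<Longrightarrow> Lp_norm (N (j + k)) s (m (j + k)) \<le> \<beta>"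
  shows "Lp_norm (N k) s (\<lambda>x. \<Sum>j<n. m (j + k) (cocycle Suc T j k x)) \<le> moment_const s * sqrt (real n + 1) * \<beta>"
  using norm
proof (induction n arbitrary: k)
  case 0
  then show ?case using \<open>0 < \<beta>\<close> moment_const_ge_1[of s] by simp
next
  case (Suc n)
  interpret prob_space "N k" by (rule prob)
  define w where "w x = (\<Sum>j<n. m (j + Suc k) (cocycle Suc T j (Suc k) x))" for x
  have w: "ess_bounded (N (Suc k)) w"
    unfolding w_def by (intro ess_bounded_sum ess_bounded_comp[OF m orbit_meas orbit_distr])
  have "Lp_norm (N k) s (\<lambda>x. w (T k x) + m k x) \<le> moment_const s * sqrt ((real n + 1) + 1) * \<beta>"
  proof (rule Lp_norm_add_le_orthogonal)
    show "ess_bounded (N k) (\<lambda>x. w (T k x))"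
      by (rule ess_bounded_comp[OF w T_meas T_distr])
    show "(\<integral>x. m k x * (sgn (w (T k x)) * \<bar>w (T k x)\<bar> powr (s - 1)) \<partial>N k) = 0"
      using s by (intro orthogonal[of k "\<lambda>y. sgn (w y) * \<bar>w y\<bar> powr (s - 1)"] ess_bounded_mult
          ess_bounded_sgn ess_bounded_abs_powr w) auto
    have "Lp_norm (N (Suc k)) s w \<le> moment_const s * sqrt (real n + 1) * \<beta>"
      unfolding w_def using Suc.prems[of "Suc j" for j] by (intro Suc.IH) simp
    then show "Lp_norm (N k) s (\<lambda>x. w (T k x)) \<le> moment_const s * sqrt (real n + 1) * \<beta>"
      by (subst Lp_norm_comp[OF T_meas T_distr]) (use w in \<open>auto simp: ess_bounded_iff\<close>)
    show "Lp_norm (N k) s (m k) \<le> \<beta>" using Suc.prems[of 0] by simp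
  qed (use m s \<open>0 < \<beta>\<close> in auto)
  also have "(\<lambda>x. w (T k x) + m k x) = (\<lambda>x. \<Sum>j<Suc n. m (j + k) (cocycle Suc T j k x))"
    unfolding w_def sum.lessThan_Suc_shift cocycle_Suc_first by (simp add: add.commute)
  finally show ?case by (simp add: add.commute)
qed

text \<open>The corrector \<open>h k\<close> sums the transfer operator images in the fibre \<open>k\<close> of all earlier
  observables. By duality \<open>m k = \<phi> k + h k - h (Suc k) \<circ> T k\<close> is orthogonal to every function of
  \<open>T k\<close>, and the Birkhoff sums of \<open>\<phi>\<close> and \<open>m\<close> differ only by \<open>h n\<close> evaluated at the end point of the orbit.
  Summability of the decay rates bounds all the functions \<open>h k\<close> with \<open>k \<le> n\<close> at once.\<close>

theorem birkhoff_moment: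
  fixes \<phi> :: "nat \<Rightarrow> 'a \<Rightarrow> real"
  assumes \<phi>: "\<And>k. ess_bounded (N k) (\<phi> k)" and s: "2 \<le> s" and "0 < n"
    and norm_\<phi>: "\<And>k. k < n \<Longrightarrow> Lp_norm (N k) s (\<phi> k) \<le> Q"
    and decay: "\<And>k j. k < n \<Longrightarrow> Lp_norm (N (j + k)) s (cocycle Suc L j k (\<phi> k)) \<le> a j * Q"
    and a: "\<And>J. (\<Sum>j<J. a (Suc j)) \<le> A" and "0 \<le> A" "0 < Q"
  shows "Lp_norm (N 0) s (\<lambda>x. \<Sum>j<n. \<phi> j (cocycle Suc T j 0 x))
      \<le> 3 * moment_const s * sqrt n * (1 + 2 * A) * Q"
proof -
  interpret prob_space "N k" for k by (rule prob)
  define h where "h k x = (\<Sum>j<k. cocycle Suc L (k - j) j (\<phi> j) x)" for k x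
  define m where "m k x = \<phi> k x + h k x - h (Suc k) (T k x)" for k x
  have v: "ess_bounded (N k) (cocycle Suc L (k - j) j (\<phi> j))" if "j \<le> k" for j k
    using iterate_ess_bounded[OF \<phi>, where k = j and n = "k - j"] that by simp
  have h: "ess_bounded (N k) (h k)" for k
    unfolding h_def using v by (intro ess_bounded_sum) auto
  have m: "ess_bounded (N k) (m k)" for k
    unfolding m_def
    by (intro ess_bounded_diff ess_bounded_add \<phi> h ess_bounded_comp[OF h T_meas T_distr])
  have v_int: "integrable (N k) (\<lambda>x. cocycle Suc L (k - j) j (\<phi> j) x * f x)"
    if "j \<le> k" "ess_bounded (N k) f" for j k f
    using that by (intro integrable_if_ess_bounded ess_bounded_mult v)
  have orthogonal: "(\<integral>x. m k x * f (T k x) \<partial>N k) = 0" if f: "ess_bounded (N (Suc k)) f" for k f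
  proof -
    note fT = ess_bounded_comp[OF f T_meas T_distr]
    \<comment> \<open>duality is applied to each summand separately, since \<open>L\<close> is additive only up to null sets\<close>
    have "(\<integral>x. (\<phi> k x + h k x) * f (T k x) \<partial>N k)
        = (\<integral>x. (\<Sum>j<Suc k. cocycle Suc L (k - j) j (\<phi> j) x * f (T k x)) \<partial>N k)"
      by (simp add: h_def sum_distrib_right distrib_right add.commute)
    also have "\<dots> = (\<Sum>j<Suc k. \<integral>x. cocycle Suc L (k - j) j (\<phi> j) x * f (T k x) \<partial>N k)"
      by (rule Bochner_Integration.integral_sum) (auto intro: v_int fT)
    also have "\<dots> = (\<Sum>j<Suc k. \<integral>x. cocycle Suc L (Suc k - j) j (\<phi> j) x * f x \<partial>N (Suc k))"
    proof (rule sum.cong)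
      fix j assume "j \<in> {..<Suc k}"
      then have "j \<le> k" by simp
      then have "cocycle Suc L (Suc k - j) j (\<phi> j) = L k (cocycle Suc L (k - j) j (\<phi> j))"
        by (simp add: Suc_diff_le)
      then show "(\<integral>x. cocycle Suc L (k - j) j (\<phi> j) x * f (T k x) \<partial>N k)
          = (\<integral>x. cocycle Suc L (Suc k - j) j (\<phi> j) x * f x \<partial>N (Suc k))"
        using transfer_operator_duality[OF transfer T_meas T_distr v[OF \<open>j \<le> k\<close>] f] by simp
    qed simp
    also have "\<dots> = (\<integral>x. (\<Sum>j<Suc k. cocycle Suc L (Suc k - j) j (\<phi> j) x * f x) \<partial>N (Suc k))"
      by (rule Bochner_Integration.integral_sum[symmetric]) (auto intro: v_int f)
    also have "\<dots> = (\<integral>x. h (Suc k) x * f x \<partial>N (Suc k))"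
      unfolding h_def sum_distrib_right ..
    also have "\<dots> = (\<integral>x. h (Suc k) x * f x \<partial>distr (N k) (N (Suc k)) (T k))"
      unfolding T_distr ..
    also have "\<dots> = (\<integral>x. h (Suc k) (T k x) * f (T k x) \<partial>N k)"
      using h[of "Suc k"] f by (intro integral_distr T_meas) (auto simp: ess_bounded_iff)
    finally have eq: "(\<integral>x. (\<phi> k x + h k x) * f (T k x) \<partial>N k) = (\<integral>x. h (Suc k) (T k x) * f (T k x) \<partial>N k)" .
    have "(\<integral>x. m k x * f (T k x) \<partial>N k)
        = (\<integral>x. (\<phi> k x + h k x) * f (T k x) - h (Suc k) (T k x) * f (T k x) \<partial>N k)"
      by (simp add: m_def algebra_simps)
    also have "\<dots> = 0"
      using eq by (subst Bochner_Integration.integral_diff)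
        (auto intro!: integrable_if_ess_bounded ess_bounded_mult ess_bounded_add \<phi> h fT
          ess_bounded_comp[OF h T_meas T_distr])
    finally show ?thesis .
  qed
  have norm_h: "Lp_norm (N k) s (h k) \<le> A * Q" if "k \<le> n" for k
  proof -
    have "Lp_norm (N k) s (h k) \<le> (\<Sum>j<k. Lp_norm (N k) s (cocycle Suc L (k - j) j (\<phi> j)))"
      unfolding h_def using v s by (intro Lp_norm_sum_le) auto
    also have "\<dots> \<le> (\<Sum>j<k. a (k - j) * Q)"
    proof (rule sum_mono)
      fix j assume "j \<in> {..<k}"
      then show "Lp_norm (N k) s (cocycle Suc L (k - j) j (\<phi> j)) \<le> a (k - j) * Q"
        using decay[of j "k - j"] that by simp
    qed
    also have "\<dots> = (\<Sum>j<k. a (Suc j)) * Q"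
      unfolding sum_distrib_right by (rule sum.reindex_bij_witness[of _ "\<lambda>j. k - Suc j" "\<lambda>j. k - Suc j"])
        (auto simp: Suc_diff_Suc)
    also have "\<dots> \<le> A * Q"
      using a \<open>0 < Q\<close> by (intro mult_right_mono) auto
    finally show ?thesis .
  qed
  have norm_m: "Lp_norm (N k) s (m k) \<le> (1 + 2 * A) * Q" if "k < n" for k
  proof -
    have "Lp_norm (N k) s (m k) \<le> Lp_norm (N k) s (\<lambda>x. \<phi> k x + h k x) + Lp_norm (N k) s (\<lambda>x. h (Suc k) (T k x))"
      unfolding m_def using s
      by (intro Lp_norm_diff_le ess_bounded_add \<phi> h ess_bounded_comp[OF h T_meas T_distr]) auto
    also have "Lp_norm (N k) s (\<lambda>x. h (Suc k) (T k x)) = Lp_norm (N (Suc k)) s (h (Suc k))"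
      using h[of "Suc k"] by (intro Lp_norm_comp[OF T_meas T_distr]) (auto simp: ess_bounded_iff)
    also have "Lp_norm (N k) s (\<lambda>x. \<phi> k x + h k x) \<le> Lp_norm (N k) s (\<phi> k) + Lp_norm (N k) s (h k)"
      using s by (intro Lp_norm_add_le \<phi> h) auto
    finally show ?thesis
      using norm_\<phi>[OF that] norm_h[of k] norm_h[of "Suc k"] that by (simp add: algebra_simps)
  qed
  have telescope: "(\<Sum>j<J. \<phi> j (cocycle Suc T j 0 x))
      = (\<Sum>j<J. m (j + 0) (cocycle Suc T j 0 x)) + h J (cocycle Suc T J 0 x)" for J x
    by (induction J) (auto simp: m_def h_def)
  have hT: "ess_bounded (N 0) (\<lambda>x. h n (cocycle Suc T n 0 x))"
    using ess_bounded_comp[OF h[of "n + 0"] orbit_meas orbit_distr] by simp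
  have "Lp_norm (N 0) s (\<lambda>x. \<Sum>j<n. \<phi> j (cocycle Suc T j 0 x))
      \<le> Lp_norm (N 0) s (\<lambda>x. \<Sum>j<n. m (j + 0) (cocycle Suc T j 0 x))
        + Lp_norm (N 0) s (\<lambda>x. h n (cocycle Suc T n 0 x))"
    unfolding telescope using s
    by (intro Lp_norm_add_le hT ess_bounded_sum ess_bounded_comp[OF m orbit_meas orbit_distr]) auto
  also have "Lp_norm (N 0) s (\<lambda>x. h n (cocycle Suc T n 0 x)) = Lp_norm (N n) s (h n)"
    using Lp_norm_comp[OF orbit_meas orbit_distr, of "h (n + 0)" n 0] h[of n] by (simp add: ess_bounded_iff)
  also have "\<dots> \<le> A * Q" by (rule norm_h) simp
  also have "Lp_norm (N 0) s (\<lambda>x. \<Sum>j<n. m (j + 0) (cocycle Suc T j 0 x))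
      \<le> moment_const s * sqrt (real n + 1) * ((1 + 2 * A) * Q)"
    using norm_m \<open>0 \<le> A\<close> \<open>0 < Q\<close> by (intro reverse_martingale_moment m s orthogonal) auto
  also have "\<dots> \<le> moment_const s * (2 * sqrt n) * ((1 + 2 * A) * Q)"
  proof (intro mult_right_mono mult_left_mono)
    have "sqrt (real n + 1) \<le> sqrt (4 * real n)"
      using \<open>0 < n\<close> by (intro real_sqrt_le_mono) auto
    then show "sqrt (real n + 1) \<le> 2 * sqrt n" by (simp add: real_sqrt_mult)
  qed (use moment_const_ge_1[of s] \<open>0 \<le> A\<close> \<open>0 < Q\<close> in auto)
  also have "A * Q \<le> moment_const s * sqrt n * ((1 + 2 * A) * Q)"
  proof -
    have "1 * 1 \<le> moment_const s * sqrt n"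
      using moment_const_ge_1[of s] \<open>0 < n\<close> by (intro mult_mono) auto
    then have "1 * ((1 + 2 * A) * Q) \<le> moment_const s * sqrt n * ((1 + 2 * A) * Q)"
      using \<open>0 \<le> A\<close> \<open>0 < Q\<close> by (intro mult_right_mono) auto
    moreover have "A * Q \<le> (1 + 2 * A) * Q"
      using \<open>0 \<le> A\<close> \<open>0 < Q\<close> by (intro mult_right_mono) auto
    ultimately show ?thesis by simp
  qed
  finally show ?thesis by (simp add: algebra_simps)
qed

end

section \<open>Growth along orbits and Lipschitz observables\<close>

lemma (in ergodic_system) funpow_shift_in_space: "\<omega> \<in> space P \<Longrightarrow> (\<sigma> ^^ n) \<omega> \<in> space P"
  by (induction n) (auto intro: measurable_space[OF shift_measurable])

lemma (in ergodic_system) funpow_shift_measurable: "\<sigma> ^^ n \<in> P \<rightarrow>\<^sub>M P"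
proof (induction n)
  case (Suc n)
  then show ?case using measurable_comp[OF Suc shift_measurable] by (simp add: comp_def)
qed (simp add: id_def)

lemma (in ergodic_system) funpow_shift_invariant: "distr P P (\<sigma> ^^ n) = P"
proof (induction n)
  case 0
  show ?case using distr_id by (simp add: id_def)
next
  case (Suc n)
  then show ?case
    using distr_distr[OF shift_measurable funpow_shift_measurable, of n] shift_invariant by (simp add: comp_def)
qed

lemma (in ergodic_system) AE_along_orbit:
  assumes "AE \<omega> in P. R \<omega>"
  shows "AE \<omega> in P. \<forall>n. R ((\<sigma> ^^ n) \<omega>)"
proof (rule AE_all_countable[THEN iffD2], rule allI)
  fix n
  show "AE \<omega> in P. R ((\<sigma> ^^ n) \<omega>)"
    by (rule AE_distrD[OF funpow_shift_measurable, of R]) (unfold funpow_shift_invariant, rule assms)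
qed

lemma summable_orbit_weights:
  fixes q \<epsilon> :: real
  assumes "0 < q" "0 < \<epsilon>"
  shows "summable (\<lambda>n. (real n + 1) powr (- 1 - q * \<epsilon>))"
proof -
  have "summable (\<lambda>n. of_nat n powr (- 1 - q * \<epsilon>) :: real)"
    using assms by (subst summable_real_powr_iff) simp
  then have "summable (\<lambda>n. of_nat (Suc n) powr (- 1 - q * \<epsilon>) :: real)"
    by (subst summable_Suc_iff)
  then show ?thesis by (simp add: add.commute)
qed

text \<open>For finite \<open>p\<close> the majorant \<open>G\<close> is the \<open>p\<close>-th root of \<open>H \<omega> = (\<Sum>n. (n + 1) powr (- 1 - p * \<epsilon>) * \<bar>f (\<sigma>\<^sup>n \<omega>)\<bar> powr p)\<close>: by
  invariance all terms have the same integral up to their summable weights, so \<open>H\<close> is integrable, and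
  comparing a single term with \<open>H\<close> gives the growth bound.\<close>

lemma (in ergodic_system) orbit_growth:
  fixes f :: "'w \<Rightarrow> real" and p :: ennreal
  assumes f: "in_Lp P p f" and p: "0 < p" and \<epsilon>: "0 < \<epsilon>"
  shows "\<exists>G. in_Lp P p G \<and> (\<forall>\<omega>. 0 \<le> G \<omega>) \<and>
    (AE \<omega> in P. \<forall>n. \<bar>f ((\<sigma> ^^ n) \<omega>)\<bar> \<le> G \<omega> * (real n + 1) powr (enn2real (1 / p) + \<epsilon>))"
proof (cases "p = top")
  case True
  then obtain C where C: "AE \<omega> in P. \<bar>f \<omega>\<bar> \<le> C"
    using f by (auto simp: ess_bounded_iff)
  have "AE \<omega> in P. \<forall>n. \<bar>f ((\<sigma> ^^ n) \<omega>)\<bar> \<le> \<bar>C\<bar> * (real n + 1) powr (enn2real (1 / p) + \<epsilon>)"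
    using AE_along_orbit[OF C]
  proof eventually_elim
    case (elim \<omega>)
    show ?case
    proof
      fix n
      have "\<bar>f ((\<sigma> ^^ n) \<omega>)\<bar> \<le> \<bar>C\<bar> * 1" using elim[rule_format, of n] by simp
      also have "\<dots> \<le> \<bar>C\<bar> * (real n + 1) powr (enn2real (1 / p) + \<epsilon>)"
        using \<epsilon> by (intro mult_left_mono ge_one_powr_ge_zero) auto
      finally show "\<bar>f ((\<sigma> ^^ n) \<omega>)\<bar> \<le> \<bar>C\<bar> * (real n + 1) powr (enn2real (1 / p) + \<epsilon>)" .
    qed
  qed
  then show ?thesis
    using True by (intro exI[of _ "\<lambda>_. \<bar>C\<bar>"]) auto
next
  case False
  define q where "q = enn2real p"
  have q: "0 < q" "p = ennreal q"
    using False p by (auto simp: q_def enn2real_positive_iff less_top)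
  have inv_p: "enn2real (1 / p) = 1 / q"
    using q by (simp add: divide_ennreal ennreal_1[symmetric] del: ennreal_1)
  have f_meas [measurable]: "f \<in> borel_measurable P"
    using f by (simp add: in_Lp_def)
  have f_int: "integrable P (\<lambda>\<omega>. \<bar>f \<omega>\<bar> powr q)"
    using f False by (simp add: in_Lp_def q_def)
  note funpow_shift_measurable[measurable]
  define w where "w n = (real n + 1) powr (- 1 - q * \<epsilon>)" for n
  have w: "0 < w n" for n by (simp add: w_def)
  define H where "H \<omega> = (\<Sum>n. ennreal (w n * \<bar>f ((\<sigma> ^^ n) \<omega>)\<bar> powr q))" for \<omega>
  have H_meas [measurable]: "H \<in> borel_measurable P"
    unfolding H_def by measurable
  define E where "E = (\<integral>\<omega>. \<bar>f \<omega>\<bar> powr q \<partial>P)"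
  have term_int: "(\<integral>\<^sup>+\<omega>. ennreal (w n * \<bar>f ((\<sigma> ^^ n) \<omega>)\<bar> powr q) \<partial>P) = ennreal (w n * E)" for n
  proof -
    have "(\<integral>\<^sup>+\<omega>. ennreal (w n * \<bar>f ((\<sigma> ^^ n) \<omega>)\<bar> powr q) \<partial>P)
        = (\<integral>\<^sup>+\<omega>. ennreal (w n * \<bar>f \<omega>\<bar> powr q) \<partial>distr P P (\<sigma> ^^ n))"
      by (rule nn_integral_distr[symmetric]) measurable
    also have "\<dots> = ennreal (\<integral>\<omega>. w n * \<bar>f \<omega>\<bar> powr q \<partial>P)"
      unfolding funpow_shift_invariant
      using f_int w[of n] by (intro nn_integral_eq_integral) auto
    finally show ?thesis by (simp add: E_def)
  qed
  have "(\<integral>\<^sup>+\<omega>. H \<omega> \<partial>P) = (\<Sum>n. ennreal (w n * E))"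
    unfolding H_def by (subst nn_integral_suminf) (auto simp: term_int)
  also have "\<dots> = ennreal (\<Sum>n. w n * E)"
  proof (rule suminf_ennreal2)
    show "0 \<le> w n * E" for n using w[of n] by (simp add: E_def)
    show "summable (\<lambda>n. w n * E)"
      unfolding w_def by (intro summable_mult2 summable_orbit_weights q \<epsilon>)
  qed
  finally have H_fin: "(\<integral>\<^sup>+\<omega>. H \<omega> \<partial>P) < \<infinity>" by simp
  have H_AE: "AE \<omega> in P. H \<omega> \<noteq> \<infinity>"
    using H_fin by (intro nn_integral_noteq_infinite) auto
  define G where "G \<omega> = enn2real (H \<omega>) powr (1 / q)" for \<omega>
  have "integrable P (\<lambda>\<omega>. enn2real (H \<omega>))"
  proof (rule integrableI_nonneg)
    have "(\<integral>\<^sup>+\<omega>. ennreal (enn2real (H \<omega>)) \<partial>P) = (\<integral>\<^sup>+\<omega>. H \<omega> \<partial>P)"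
      using H_AE by (intro nn_integral_cong_AE) (auto simp: less_top)
    then show "(\<integral>\<^sup>+\<omega>. ennreal (enn2real (H \<omega>)) \<partial>P) < \<infinity>" using H_fin by simp
  qed auto
  then have G: "in_Lp P p G"
    using q False unfolding G_def in_Lp_def by (simp add: powr_powr)
  have "AE \<omega> in P. \<forall>n. \<bar>f ((\<sigma> ^^ n) \<omega>)\<bar> \<le> G \<omega> * (real n + 1) powr (enn2real (1 / p) + \<epsilon>)"
    using H_AE
  proof eventually_elim
    case (elim \<omega>)
    show ?case
    proof
      fix n
      have "ennreal (w n * \<bar>f ((\<sigma> ^^ n) \<omega>)\<bar> powr q) \<le> H \<omega>"
        unfolding H_def using sum_le_suminf[of "\<lambda>n. ennreal (w n * \<bar>f ((\<sigma> ^^ n) \<omega>)\<bar> powr q)" "{n}"] by simp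
      also have "H \<omega> = ennreal (enn2real (H \<omega>))"
        using elim by (simp add: less_top)
      finally have "w n * \<bar>f ((\<sigma> ^^ n) \<omega>)\<bar> powr q \<le> enn2real (H \<omega>)"
        by (simp add: ennreal_le_iff)
      then have "(real n + 1) powr (1 + q * \<epsilon>) * (w n * \<bar>f ((\<sigma> ^^ n) \<omega>)\<bar> powr q)
          \<le> (real n + 1) powr (1 + q * \<epsilon>) * enn2real (H \<omega>)"
        by (intro mult_left_mono) auto
      moreover have "(real n + 1) powr (1 + q * \<epsilon>) * w n = 1"
        unfolding w_def by (simp add: powr_add[symmetric])
      ultimately have "\<bar>f ((\<sigma> ^^ n) \<omega>)\<bar> powr q \<le> (real n + 1) powr (1 + q * \<epsilon>) * enn2real (H \<omega>)"
        by (simp add: mult.assoc[symmetric])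
      then have "(\<bar>f ((\<sigma> ^^ n) \<omega>)\<bar> powr q) powr (1 / q)
          \<le> ((real n + 1) powr (1 + q * \<epsilon>) * enn2real (H \<omega>)) powr (1 / q)"
        using q by (intro powr_mono2) auto
      also have "\<dots> = (real n + 1) powr ((1 + q * \<epsilon>) / q) * G \<omega>"
        by (simp add: powr_mult powr_powr G_def)
      also have "(1 + q * \<epsilon>) / q = 1 / q + \<epsilon>"
        using q by (simp add: field_simps)
      finally show "\<bar>f ((\<sigma> ^^ n) \<omega>)\<bar> \<le> G \<omega> * (real n + 1) powr (enn2real (1 / p) + \<epsilon>)"
        using q unfolding inv_p by (simp add: powr_powr mult.commute)
    qed
  qed
  then show ?thesis
    using G by (intro exI[of _ G]) (auto simp: G_def)
qed

lemma in_Lp_powr_dominated: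
  assumes "f \<in> borel_measurable M" "integrable M g" "\<And>x. \<bar>f x\<bar> powr enn2real p \<le> g x" "p \<noteq> top"
  shows "in_Lp M p f"
proof -
  have "integrable M (\<lambda>x. \<bar>f x\<bar> powr enn2real p)"
  proof (rule Bochner_Integration.integrable_bound[OF assms(2)])
    show "AE x in M. norm (\<bar>f x\<bar> powr enn2real p) \<le> norm (g x)"
      using assms(3) by (intro AE_I2) (auto intro: order_trans[OF _ abs_ge_self])
  qed (use assms in auto)
  then show ?thesis using assms by (simp add: in_Lp_def)
qed

lemma (in prob_space) in_Lp_one_add:
  assumes "in_Lp M p f"
  shows "in_Lp M p (\<lambda>x. 1 + f x)"
proof (cases "p = top")
  case True
  then show ?thesis using assms ess_bounded_add[OF ess_bounded_const[of M 1]] by simp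
next
  case False
  define q where "q = enn2real p"
  have q: "0 \<le> q" by (simp add: q_def)
  show ?thesis
  proof (rule in_Lp_powr_dominated)
    show "\<bar>1 + f x\<bar> powr enn2real p \<le> 2 powr q * (1 + \<bar>f x\<bar> powr q)" for x
    proof -
      have "\<bar>1 + f x\<bar> powr q \<le> (2 * max 1 \<bar>f x\<bar>) powr q"
        using q by (intro powr_mono2) auto
      also have "\<dots> \<le> 2 powr q * (1 + \<bar>f x\<bar> powr q)"
        unfolding powr_mult by (intro mult_left_mono) (auto simp: max_def)
      finally show ?thesis by (simp add: q_def)
    qed
    show "integrable M (\<lambda>x. 2 powr q * (1 + \<bar>f x\<bar> powr q))"
      using assms False by (simp add: in_Lp_def q_def)
  qed (use assms False in \<open>auto simp: in_Lp_def\<close>)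
qed

lemma in_Lp_cmult:
  assumes "in_Lp M p f"
  shows "in_Lp M p (\<lambda>x. c * f x)"
proof (cases "p = top")
  case True
  then show ?thesis using assms ess_bounded_cmult by blast
next
  case False
  then show ?thesis using assms by (auto simp: in_Lp_def abs_mult powr_mult)
qed

lemma in_Lp_mult_ess_bounded:
  assumes f: "ess_bounded M f" and g: "in_Lp M r g"
  shows "in_Lp M r (\<lambda>x. f x * g x)"
proof (cases "r = top")
  case True
  then show ?thesis using assms ess_bounded_mult by blast
next
  case False
  obtain C where C: "AE x in M. \<bar>f x\<bar> \<le> C"
    using f by (auto simp: ess_bounded_iff)
  have [measurable]: "f \<in> borel_measurable M" "g \<in> borel_measurable M"
    using assms by (auto simp: in_Lp_def)
  have int: "integrable M (\<lambda>x. \<bar>C\<bar> powr enn2real r * \<bar>g x\<bar> powr enn2real r)"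
    using g False by (simp add: in_Lp_def)
  have "integrable M (\<lambda>x. \<bar>f x * g x\<bar> powr enn2real r)"
  proof (rule Bochner_Integration.integrable_bound[OF int])
    show "AE x in M. norm (\<bar>f x * g x\<bar> powr enn2real r) \<le> norm (\<bar>C\<bar> powr enn2real r * \<bar>g x\<bar> powr enn2real r)"
      using C by eventually_elim (auto simp: abs_mult powr_mult intro!: mult_right_mono powr_mono2)
  qed simp
  then show ?thesis using False by (simp add: in_Lp_def)
qed

text \<open>In the finite case \<open>\<bar>f\<bar>\<close> and \<open>\<bar>g\<bar>\<close> are at most \<open>m powr (1 / p)\<close> and \<open>m powr (1 / r)\<close> with
  \<open>m = max (\<bar>f\<bar> powr p) (\<bar>g\<bar> powr r)\<close>, so \<open>\<bar>f * g\<bar> powr \<rho> \<le> m\<close>. This suffices for membership.\<close>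

lemma in_Lp_mult:
  fixes p r \<rho> :: ennreal
  assumes f: "in_Lp M p f" and g: "in_Lp M r g" and "0 < p" "0 < r" and \<rho>: "1 / \<rho> = 1 / p + 1 / r"
  shows "in_Lp M \<rho> (\<lambda>x. f x * g x)"
proof -
  have inj: "x = y" if "1 / x = 1 / y" for x y :: ennreal
  proof -
    have "inverse (inverse z) = z" for z :: ennreal
    proof (cases z)
      case (real t)
      then show ?thesis
        by (cases "t = 0") (simp_all add: inverse_ennreal)
    qed simp
    moreover have "inverse x = inverse y"
      using that by (simp add: divide_ennreal_def)
    ultimately show ?thesis by metis
  qed
  consider "p = top" | "r = top" | "p \<noteq> top" "r \<noteq> top" by blast
  then show ?thesis
  proof cases
    case 1
    then have "1 / \<rho> = 1 / r" using \<rho> by simp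
    then have "\<rho> = r" by (rule inj)
    then show ?thesis using 1 in_Lp_mult_ess_bounded f g by blast
  next
    case 2
    then have "1 / \<rho> = 1 / p" using \<rho> by simp
    then have "\<rho> = p" by (rule inj)
    then show ?thesis using 2 in_Lp_mult_ess_bounded[of M g p f] f g by (simp add: mult.commute)
  next
    case 3
    define a b where "a = enn2real p" and "b = enn2real r"
    have a: "0 < a" "p = ennreal a" and b: "0 < b" "r = ennreal b"
      using 3 \<open>0 < p\<close> \<open>0 < r\<close> by (auto simp: a_def b_def enn2real_positive_iff less_top)
    \<comment> \<open>the real number representing \<open>\<rho>\<close>\<close>
    define c where "c = a * b / (a + b)"
    have c: "0 < c" using a b by (simp add: c_def)
    have "1 / \<rho> = 1 / ennreal c"
    proof -
      have "1 / p + 1 / r = ennreal (1 / a) + ennreal (1 / b)"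
        using a b by (simp add: divide_ennreal[symmetric])
      also have "\<dots> = ennreal (1 / a + 1 / b)"
        using a b by simp
      also have "1 / a + 1 / b = 1 / c"
        using a b by (simp add: c_def field_simps)
      finally show ?thesis using \<rho> c by (simp add: divide_ennreal[symmetric])
    qed
    then have \<rho>_eq: "\<rho> = ennreal c" by (rule inj)
    have [measurable]: "f \<in> borel_measurable M" "g \<in> borel_measurable M"
      using f g by (auto simp: in_Lp_def)
    show ?thesis
    proof (rule in_Lp_powr_dominated)
      show "integrable M (\<lambda>x. \<bar>f x\<bar> powr a + \<bar>g x\<bar> powr b)"
        using f g 3 by (simp add: in_Lp_def a_def b_def)
      show "\<bar>f x * g x\<bar> powr enn2real \<rho> \<le> \<bar>f x\<bar> powr a + \<bar>g x\<bar> powr b" for x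
      proof -
        define m where "m = max (\<bar>f x\<bar> powr a) (\<bar>g x\<bar> powr b)"
        have "\<bar>f x * g x\<bar> powr c = (\<bar>f x\<bar> powr a) powr (c / a) * (\<bar>g x\<bar> powr b) powr (c / b)"
          using a b by (simp add: abs_mult powr_mult powr_powr)
        also have "\<dots> \<le> m powr (c / a) * m powr (c / b)"
          using a b c by (intro mult_mono powr_mono2) (auto simp: m_def)
        also have "\<dots> = m powr (c / a + c / b)" by (simp add: powr_add)
        also have "c / a + c / b = 1"
          using a b by (simp add: c_def add_divide_distrib[symmetric] add.commute)
        also have "m powr 1 \<le> \<bar>f x\<bar> powr a + \<bar>g x\<bar> powr b"
          by (auto simp: m_def max_def)
        finally show ?thesis using c by (simp add: \<rho>_eq)
      qed
    qed (auto simp: \<rho>_eq)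
  qed
qed

lemma bdd_lipschitz_on_abs_le_lip_norm:
  assumes "bdd_lipschitz_on A f" "x \<in> A"
  shows "\<bar>f x\<bar> \<le> lip_norm A f"
proof -
  have "\<exists>B. \<forall>x\<in>A. \<bar>f x\<bar> \<le> B"
    using assms(1) by (auto simp: bdd_lipschitz_on_def bounded_iff)
  then have "bdd_above ((\<lambda>x. \<bar>f x\<bar>) ` A)"
    by (auto intro: bdd_aboveI2)
  then have "\<bar>f x\<bar> \<le> (SUP x\<in>A. \<bar>f x\<bar>)"
    using assms(2) by (rule cSUP_upper2) simp
  moreover have "0 \<le> Inf {C. C-lipschitz_on A f}"
    using assms(1) by (intro cInf_greatest) (auto simp: bdd_lipschitz_on_def lipschitz_on_def)
  ultimately show ?thesis by (simp add: lip_norm_def)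
qed

lemma bdd_lipschitz_on_one: "bdd_lipschitz_on A (\<lambda>_. 1)"
  by (auto simp: bdd_lipschitz_on_def bounded_iff lipschitz_on_def intro: exI[of _ 1] exI[of _ 0])

lemma lip_norm_one_le:
  assumes "A \<noteq> {}"
  shows "lip_norm A (\<lambda>_. 1) \<le> 1"
proof -
  have "Inf {C. C-lipschitz_on A (\<lambda>_. 1 :: real)} \<le> 0"
    by (rule cInf_lower) (auto simp: lipschitz_on_def intro!: bdd_belowI)
  then show ?thesis using assms by (simp add: lip_norm_def)
qed

lemma bdd_lipschitz_on_measurable:
  assumes "bdd_lipschitz_on A f"
  shows "f \<in> borel_measurable (restrict_space borel A)"
proof (rule borel_measurable_continuous_on_restrict)
  show "continuous_on A f"
    using assms lipschitz_on_continuous_on by (auto simp: bdd_lipschitz_on_def)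
qed

text \<open>Translates between cocycles over the base and compositions along a fixed orbit.\<close>

lemma cocycle_along_orbit:
  "cocycle \<sigma> A n ((\<sigma> ^^ k) \<omega>) = cocycle Suc (\<lambda>k. A ((\<sigma> ^^ k) \<omega>)) n k"
  by (induction n) (simp_all add: funpow_add)

section \<open>Moments of Birkhoff sums in random systems\<close>

lemma (in random_system) space_\<mu>: "\<omega> \<in> space P \<Longrightarrow> space (\<mu> \<omega>) = X \<omega>"
  using sets_eq_imp_space_eq[OF \<mu>_sets] by (simp add: space_restrict_space)

lemma (in random_system) fibre_map_measurable:
  assumes \<omega>: "\<omega> \<in> space P"
  shows "T \<omega> \<in> \<mu> \<omega> \<rightarrow>\<^sub>M \<mu> (\<sigma> \<omega>)"
proof -
  have \<sigma>\<omega>: "\<sigma> \<omega> \<in> space P"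
    using measurable_space[OF shift_measurable \<omega>] .
  have "(\<lambda>x. x) \<in> \<mu> \<omega> \<rightarrow>\<^sub>M borel"
    unfolding measurable_cong_sets[OF \<mu>_sets[OF \<omega>] refl] by (intro measurable_restrict_space1) simp
  then have "(\<lambda>x. (\<omega>, x)) \<in> \<mu> \<omega> \<rightarrow>\<^sub>M P \<Otimes>\<^sub>M borel"
    using \<omega> by (intro measurable_Pair) auto
  then have "(\<lambda>x. (\<omega>, x)) \<in> \<mu> \<omega> \<rightarrow>\<^sub>M total_space P X"
    unfolding total_space_def using \<omega> by (intro measurable_restrict_space2) (auto simp: space_\<mu>)
  from measurable_compose[OF this T_measurable] have "T \<omega> \<in> \<mu> \<omega> \<rightarrow>\<^sub>M borel" by simp
  then have "T \<omega> \<in> \<mu> \<omega> \<rightarrow>\<^sub>M restrict_space borel (X (\<sigma> \<omega>))"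
    using T_into[OF \<omega>] by (intro measurable_restrict_space2) (auto simp: space_\<mu>[OF \<omega>])
  then show ?thesis
    unfolding measurable_cong_sets[OF refl \<mu>_sets[OF \<sigma>\<omega>]] .
qed

lemma (in random_system) AE_transfer_chain:
  "AE \<omega> in P. transfer_chain (\<lambda>k. \<mu> ((\<sigma> ^^ k) \<omega>)) (\<lambda>k. T ((\<sigma> ^^ k) \<omega>)) (\<lambda>k. L ((\<sigma> ^^ k) \<omega>))"
  using AE_space AE_along_orbit[OF \<mu>_equivariant] AE_along_orbit[OF L_transfer]
proof eventually_elim
  case (elim \<omega>)
  show ?case
  proof (rule transfer_chain.intro)
    fix k
    note in_space = funpow_shift_in_space[OF elim(1)]
    show "prob_space (\<mu> ((\<sigma> ^^ k) \<omega>))"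
      by (rule \<mu>_prob[OF in_space])
    show "T ((\<sigma> ^^ k) \<omega>) \<in> \<mu> ((\<sigma> ^^ k) \<omega>) \<rightarrow>\<^sub>M \<mu> ((\<sigma> ^^ Suc k) \<omega>)"
      using fibre_map_measurable[OF in_space, of k] by simp
    show "distr (\<mu> ((\<sigma> ^^ k) \<omega>)) (\<mu> ((\<sigma> ^^ Suc k) \<omega>)) (T ((\<sigma> ^^ k) \<omega>)) = \<mu> ((\<sigma> ^^ Suc k) \<omega>)"
      using elim(2) by simp
    show "is_transfer_operator (\<mu> ((\<sigma> ^^ k) \<omega>)) (\<mu> ((\<sigma> ^^ Suc k) \<omega>)) (T ((\<sigma> ^^ k) \<omega>)) (L ((\<sigma> ^^ k) \<omega>))"
      using elim(3) by simp
  qed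
qed

lemma (in random_system) fibre_observable_bounds:
  assumes \<omega>: "\<omega> \<in> space P" and g: "bdd_lipschitz_on (X \<omega>) g" and "0 < s"
  shows "ess_bounded (\<mu> \<omega>) g" "Lp_norm (\<mu> \<omega>) s g \<le> lip_norm (X \<omega>) g" "0 \<le> lip_norm (X \<omega>) g"
proof -
  interpret \<mu>: prob_space "\<mu> \<omega>" by (rule \<mu>_prob[OF \<omega>])
  have bound: "AE x in \<mu> \<omega>. \<bar>g x\<bar> \<le> lip_norm (X \<omega>) g"
    using bdd_lipschitz_on_abs_le_lip_norm[OF g] by (intro AE_I2) (auto simp: space_\<mu>[OF \<omega>])
  have meas: "g \<in> borel_measurable (\<mu> \<omega>)"
    unfolding measurable_cong_sets[OF \<mu>_sets[OF \<omega>] refl] by (rule bdd_lipschitz_on_measurable[OF g])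
  show "ess_bounded (\<mu> \<omega>) g"
    by (rule ess_boundedI[OF meas bound])
  obtain x where "x \<in> X \<omega>"
    using \<mu>.not_empty space_\<mu>[OF \<omega>] by auto
  then show nonneg: "0 \<le> lip_norm (X \<omega>) g"
    using bdd_lipschitz_on_abs_le_lip_norm[OF g] by force
  show "Lp_norm (\<mu> \<omega>) s g \<le> lip_norm (X \<omega>) g"
    by (rule \<mu>.Lp_norm_le_bound[OF meas bound \<open>0 < s\<close> nonneg])
qed

text \<open>The decay condition with first observable \<open>1\<close>, whose Lipschitz norm is at most \<open>1\<close>, placed in the same
  fibre as \<open>g\<close>. The absolute value of \<open>K\<close> makes the right-hand side monotone in the remaining factors.\<close>

lemma (in random_system) decay_single_observable:
  assumes "decay_condition P \<sigma> X \<mu> L {s} p (\<lambda>_. a)" and "0 < s"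
  shows "\<exists>K. in_Lp P p K \<and> (AE \<omega> in P. \<forall>k n g. bdd_lipschitz_on (X ((\<sigma> ^^ k) \<omega>)) g \<longrightarrow>
      Lp_norm (\<mu> ((\<sigma> ^^ (n + k)) \<omega>)) s
          (centered (\<mu> ((\<sigma> ^^ (n + k)) \<omega>)) (cocycle \<sigma> L n ((\<sigma> ^^ k) \<omega>) g))
        \<le> 2 * \<bar>K ((\<sigma> ^^ k) \<omega>)\<bar> * a n * (1 + lip_norm (X ((\<sigma> ^^ k) \<omega>)) g))"
proof -
  have a_pos: "0 < a n" for n
    using assms(1) by (simp add: decay_condition_def)
  from assms(1)[unfolded decay_condition_def Let_def, THEN conjunct2, THEN conjunct2, THEN conjunct2, THEN conjunct2]
  obtain K where K: "in_Lp P p K" and "AE \<omega> in P. \<forall>s\<in>{s}. \<forall>r' i j g1 g2.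
           r' \<le> i \<longrightarrow> i \<le> j \<longrightarrow>
           bdd_lipschitz_on (X ((\<sigma> ^^ r') \<omega>)) g1 \<longrightarrow>
           bdd_lipschitz_on (X ((\<sigma> ^^ i) \<omega>)) g2 \<longrightarrow>
           in_Lp (\<mu> ((\<sigma> ^^ j) \<omega>)) (ennreal s) (centered (\<mu> ((\<sigma> ^^ j) \<omega>))
                      (cocycle \<sigma> L (j - i) ((\<sigma> ^^ i) \<omega>)
                        (\<lambda>x. g2 x * cocycle \<sigma> L (i - r') ((\<sigma> ^^ r') \<omega>) g1 x))) \<and>
           Lp_norm (\<mu> ((\<sigma> ^^ j) \<omega>)) s (centered (\<mu> ((\<sigma> ^^ j) \<omega>))
                      (cocycle \<sigma> L (j - i) ((\<sigma> ^^ i) \<omega>)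
                        (\<lambda>x. g2 x * cocycle \<sigma> L (i - r') ((\<sigma> ^^ r') \<omega>) g1 x))) \<le>
                 K ((\<sigma> ^^ i) \<omega>) * a (j - i) *
                 (1 + lip_norm (X ((\<sigma> ^^ r') \<omega>)) g1) * (1 + lip_norm (X ((\<sigma> ^^ i) \<omega>)) g2)"
    by blast
  from this(2) have "AE \<omega> in P. \<forall>k n g. bdd_lipschitz_on (X ((\<sigma> ^^ k) \<omega>)) g \<longrightarrow>
      Lp_norm (\<mu> ((\<sigma> ^^ (n + k)) \<omega>)) s
          (centered (\<mu> ((\<sigma> ^^ (n + k)) \<omega>)) (cocycle \<sigma> L n ((\<sigma> ^^ k) \<omega>) g))
        \<le> 2 * \<bar>K ((\<sigma> ^^ k) \<omega>)\<bar> * a n * (1 + lip_norm (X ((\<sigma> ^^ k) \<omega>)) g)"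
    using AE_space
  proof eventually_elim
    case (elim \<omega>)
    show ?case
    proof (intro allI impI)
      fix k n and g :: "'m \<Rightarrow> real"
      assume g: "bdd_lipschitz_on (X ((\<sigma> ^^ k) \<omega>)) g"
      note decay = elim(1) and \<omega> = elim(2)
      note in_space = funpow_shift_in_space[OF \<omega>, of k]
      have "X ((\<sigma> ^^ k) \<omega>) \<noteq> {}"
        using prob_space.not_empty[OF \<mu>_prob[OF in_space]] space_\<mu>[OF in_space] by simp
      then have one: "lip_norm (X ((\<sigma> ^^ k) \<omega>)) (\<lambda>_. 1) \<le> 1"
        by (rule lip_norm_one_le)
      have "Lp_norm (\<mu> ((\<sigma> ^^ (n + k)) \<omega>)) s
            (centered (\<mu> ((\<sigma> ^^ (n + k)) \<omega>)) (cocycle \<sigma> L n ((\<sigma> ^^ k) \<omega>) g))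
          \<le> K ((\<sigma> ^^ k) \<omega>) * a n *
            (1 + lip_norm (X ((\<sigma> ^^ k) \<omega>)) (\<lambda>_. 1)) * (1 + lip_norm (X ((\<sigma> ^^ k) \<omega>)) g)"
        using decay[rule_format, of s k k "n + k", OF _ _ _ bdd_lipschitz_on_one g] by simp
      also have "\<dots> \<le> \<bar>K ((\<sigma> ^^ k) \<omega>)\<bar> * a n * (1 + 1) * (1 + lip_norm (X ((\<sigma> ^^ k) \<omega>)) g)"
        using one fibre_observable_bounds(3)[OF in_space bdd_lipschitz_on_one \<open>0 < s\<close>]
          fibre_observable_bounds(3)[OF in_space g \<open>0 < s\<close>] a_pos[of n]
        by (intro mult_mono mult_right_mono) auto
      finally show "Lp_norm (\<mu> ((\<sigma> ^^ (n + k)) \<omega>)) s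
            (centered (\<mu> ((\<sigma> ^^ (n + k)) \<omega>)) (cocycle \<sigma> L n ((\<sigma> ^^ k) \<omega>) g))
          \<le> 2 * \<bar>K ((\<sigma> ^^ k) \<omega>)\<bar> * a n * (1 + lip_norm (X ((\<sigma> ^^ k) \<omega>)) g)"
        by simp
    qed
  qed
  then show ?thesis using K by blast
qed

theorem theorem6:
  fixes P :: "'w measure"
    and \<sigma> :: "'w \<Rightarrow> 'w"
    and X :: "'w \<Rightarrow> 'm::metric_space set"
    and T :: "'w \<Rightarrow> 'm \<Rightarrow> 'm"
    and \<mu> :: "'w \<Rightarrow> 'm measure"
    and L :: "'w \<Rightarrow> ('m \<Rightarrow> real) \<Rightarrow> 'm \<Rightarrow> real"
    and \<phi> :: "'w \<times> 'm \<Rightarrow> real"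
    and \<Phi> :: "'w \<Rightarrow> real"
    and p r \<rho> :: ennreal
    and s :: real
    and a :: "nat \<Rightarrow> real"
  assumes "random_system P \<sigma> X T \<mu> L"
    and "\<phi> \<in> borel_measurable (total_space P X)"
    and "AE \<omega> in P. (\<integral>x. \<phi> (\<omega>, x) \<partial>\<mu> \<omega>) = 0"
    and "AE \<omega> in P. bdd_lipschitz_on (X \<omega>) (\<lambda>x. \<phi> (\<omega>, x))"
    \<comment> \<open>\<open>\<Phi>\<close> is a version of the a.e. defined function \<open>\<omega> \<mapsto> \<parallel>\<phi>\<^sub>\<omega>\<parallel>\<close> (Lipschitz norm)\<close>
    and "AE \<omega> in P. \<Phi> \<omega> = lip_norm (X \<omega>) (\<lambda>x. \<phi> (\<omega>, x))"
    and "r > 0"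
    and "in_Lp P r \<Phi>"
    and "s \<ge> 2"
    and "p > 0"
    and "decay_condition P \<sigma> X \<mu> L {s} p (\<lambda>_. a)"
    and "summable (\<lambda>n. a (Suc n))"
    and "1 / \<rho> = 1 / p + 1 / r"
  shows "\<forall>\<delta>>0. \<exists>Kbar. in_Lp P \<rho> Kbar \<and>
           (AE \<omega> in P. \<forall>n. in_Lp (\<mu> \<omega>) (ennreal s) (birkhoff_sum \<sigma> T \<phi> n \<omega>) \<and>
              Lp_norm (\<mu> \<omega>) s (birkhoff_sum \<sigma> T \<phi> n \<omega>)
                \<le> Kbar \<omega> * real n powr (1 / 2 + enn2real (1 / p) + enn2real (1 / r) + \<delta>))"
proof (intro allI impI)
  fix \<delta> :: real assume "0 < \<delta>"
  interpret random_system P \<sigma> X T \<mu> L by fact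
  note s = \<open>s \<ge> 2\<close>
  obtain K where K: "in_Lp P p K"
    and decay: "AE \<omega> in P. \<forall>k n g. bdd_lipschitz_on (X ((\<sigma> ^^ k) \<omega>)) g \<longrightarrow>
        Lp_norm (\<mu> ((\<sigma> ^^ (n + k)) \<omega>)) s
            (centered (\<mu> ((\<sigma> ^^ (n + k)) \<omega>)) (cocycle \<sigma> L n ((\<sigma> ^^ k) \<omega>) g))
          \<le> 2 * \<bar>K ((\<sigma> ^^ k) \<omega>)\<bar> * a n * (1 + lip_norm (X ((\<sigma> ^^ k) \<omega>)) g)"
    using decay_single_observable[OF assms(10)] s by auto
  have a_pos: "0 < a n" for n
    using assms(10) by (simp add: decay_condition_def)
  define A where "A = (\<Sum>n. a (Suc n))"
  have A: "(\<Sum>j<J. a (Suc j)) \<le> A" for J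
    unfolding A_def using a_pos assms(11) by (intro sum_le_suminf) (auto intro: less_imp_le)
  have "0 \<le> A" using A[of 0] by simp
  \<comment> \<open>\<open>K\<close> and \<open>\<Phi>\<close> each use up half of the margin \<open>\<delta>\<close>\<close>
  define \<epsilon> where "\<epsilon> = \<delta> / 2"
  have "0 < \<epsilon>" using \<open>0 < \<delta>\<close> by (simp add: \<epsilon>_def)
  define u v where "u = enn2real (1 / p) + \<epsilon>" and "v = enn2real (1 / r) + \<epsilon>"
  have uv: "0 \<le> u" "0 \<le> v" using \<open>0 < \<epsilon>\<close> by (auto simp: u_def v_def)
  obtain G1 where G1: "in_Lp P p G1" "\<And>\<omega>. 0 \<le> G1 \<omega>"
    and K_growth: "AE \<omega> in P. \<forall>n. \<bar>K ((\<sigma> ^^ n) \<omega>)\<bar> \<le> G1 \<omega> * (real n + 1) powr u"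
    using orbit_growth[OF K \<open>0 < p\<close> \<open>0 < \<epsilon>\<close>] by (auto simp: u_def)
  obtain G2 where G2: "in_Lp P r G2" "\<And>\<omega>. 0 \<le> G2 \<omega>"
    and \<Phi>_growth: "AE \<omega> in P. \<forall>n. \<bar>\<Phi> ((\<sigma> ^^ n) \<omega>)\<bar> \<le> G2 \<omega> * (real n + 1) powr v"
    using orbit_growth[OF assms(7) \<open>0 < r\<close> \<open>0 < \<epsilon>\<close>] by (auto simp: v_def)
  define c where "c = 6 * moment_const s * (1 + 2 * A)"
  define Kbar where "Kbar \<omega> = c * ((1 + G1 \<omega>) * (1 + G2 \<omega>))" for \<omega>
  have "in_Lp P \<rho> Kbar"
    unfolding Kbar_def using assms(12) \<open>0 < p\<close> \<open>0 < r\<close> G1(1) G2(1)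
    by (intro in_Lp_cmult in_Lp_mult[of P p _ r] in_Lp_one_add) auto
  moreover have "AE \<omega> in P. \<forall>n. in_Lp (\<mu> \<omega>) (ennreal s) (birkhoff_sum \<sigma> T \<phi> n \<omega>) \<and>
      Lp_norm (\<mu> \<omega>) s (birkhoff_sum \<sigma> T \<phi> n \<omega>)
        \<le> Kbar \<omega> * real n powr (1 / 2 + enn2real (1 / p) + enn2real (1 / r) + \<delta>)"
    using AE_space AE_transfer_chain AE_along_orbit[OF assms(3)] AE_along_orbit[OF assms(4)]
      AE_along_orbit[OF assms(5)] K_growth \<Phi>_growth decay
  proof eventually_elim
    case (elim \<omega>)
    note mean_zero = elim(3)[rule_format] and lipschitz = elim(4)[rule_format]
      and \<Phi> = elim(5)[rule_format] and K_le = elim(6)[rule_format] and \<Phi>_le = elim(7)[rule_format]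
      and decay = elim(8)[rule_format]
    note in_space = funpow_shift_in_space[OF elim(1)]
    interpret transfer_chain "\<lambda>k. \<mu> ((\<sigma> ^^ k) \<omega>)" "\<lambda>k. T ((\<sigma> ^^ k) \<omega>)" "\<lambda>k. L ((\<sigma> ^^ k) \<omega>)"
      by (rule elim(2))
    define f where "f k x = \<phi> ((\<sigma> ^^ k) \<omega>, x)" for k x
    have f_lipschitz: "bdd_lipschitz_on (X ((\<sigma> ^^ k) \<omega>)) (f k)" for k
      using lipschitz[of k] by (simp add: f_def[abs_def])
    have f_bounds: "ess_bounded (\<mu> ((\<sigma> ^^ k) \<omega>)) (f k)"
        "Lp_norm (\<mu> ((\<sigma> ^^ k) \<omega>)) s (f k) \<le> \<Phi> ((\<sigma> ^^ k) \<omega>)" "0 \<le> \<Phi> ((\<sigma> ^^ k) \<omega>)" for k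
      using fibre_observable_bounds[OF in_space f_lipschitz, of s k] s \<Phi>[of k]
      by (auto simp: f_def[abs_def])
    have f_decay: "Lp_norm (\<mu> ((\<sigma> ^^ (j + k)) \<omega>)) s (cocycle Suc (\<lambda>k. L ((\<sigma> ^^ k) \<omega>)) j k (f k))
        \<le> 2 * \<bar>K ((\<sigma> ^^ k) \<omega>)\<bar> * a j * (1 + \<Phi> ((\<sigma> ^^ k) \<omega>))" for j k
    proof -
      define g where "g = cocycle Suc (\<lambda>k. L ((\<sigma> ^^ k) \<omega>)) j k (f k)"
      \<comment> \<open>the observable has mean zero and transfer operators preserve integrals, so \<open>g\<close> is already centered\<close>
      have "(\<integral>x. g x \<partial>\<mu> ((\<sigma> ^^ (j + k)) \<omega>)) = 0"
        unfolding g_def using iterate_integral[OF f_bounds(1)] mean_zero[of k] by (simp add: f_def[abs_def])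
      then have "centered (\<mu> ((\<sigma> ^^ (j + k)) \<omega>)) g = g"
        by (simp add: centered_def fun_eq_iff)
      moreover have "g = cocycle \<sigma> L j ((\<sigma> ^^ k) \<omega>) (f k)"
        unfolding g_def by (simp add: cocycle_along_orbit)
      ultimately have "Lp_norm (\<mu> ((\<sigma> ^^ (j + k)) \<omega>)) s g
          \<le> 2 * \<bar>K ((\<sigma> ^^ k) \<omega>)\<bar> * a j * (1 + lip_norm (X ((\<sigma> ^^ k) \<omega>)) (f k))"
        using decay[OF f_lipschitz[of k], of j] by simp
      also have "lip_norm (X ((\<sigma> ^^ k) \<omega>)) (f k) = \<Phi> ((\<sigma> ^^ k) \<omega>)"
        using \<Phi>[of k] by (simp add: f_def[abs_def])
      finally show ?thesis unfolding g_def .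
    qed
    have birkhoff: "birkhoff_sum \<sigma> T \<phi> n \<omega>
        = (\<lambda>x. \<Sum>j<n. f j (cocycle Suc (\<lambda>k. T ((\<sigma> ^^ k) \<omega>)) j 0 x))" for n
      using cocycle_along_orbit[of \<sigma> T _ 0 \<omega>] by (auto simp: birkhoff_sum_def f_def)
    have "ess_bounded (\<mu> \<omega>) (birkhoff_sum \<sigma> T \<phi> n \<omega>)" for n
      unfolding birkhoff
      using ess_bounded_comp[OF f_bounds(1)[of "j + 0" for j] orbit_meas orbit_distr] by (auto intro!: ess_bounded_sum)
    then have "in_Lp (\<mu> \<omega>) (ennreal s) (birkhoff_sum \<sigma> T \<phi> n \<omega>)" for n
      using s finite_measure.in_Lp_if_ess_bounded[of "\<mu> \<omega>"] prob_space.finite_measure[OF \<mu>_prob[OF elim(1)]] by simp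
    moreover have "Lp_norm (\<mu> \<omega>) s (birkhoff_sum \<sigma> T \<phi> n \<omega>)
        \<le> Kbar \<omega> * real n powr (1 / 2 + enn2real (1 / p) + enn2real (1 / r) + \<delta>)" for n
    proof (cases "n = 0")
      case True
      then show ?thesis by (simp add: birkhoff)
    next
      case False
      \<comment> \<open>uniform bounds for \<open>\<bar>K\<bar>\<close> and \<open>1 + \<Phi>\<close> along the first \<open>n\<close> points of the orbit of \<open>\<omega>\<close>\<close>
      define U V where "U = (1 + G1 \<omega>) * real n powr u" and "V = (1 + G2 \<omega>) * real n powr v"
      have powr_ge_1: "1 \<le> real n powr u" "1 \<le> real n powr v"
        using False uv by (auto intro!: ge_one_powr_ge_zero)
      have U1: "1 \<le> U" and V1: "1 \<le> V"
        unfolding U_def V_def using powr_ge_1 G1(2) G2(2) mult_mono[of 1 "1 + G1 \<omega>" 1 "real n powr u"]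
          mult_mono[of 1 "1 + G2 \<omega>" 1 "real n powr v"] by auto
      have K_U: "\<bar>K ((\<sigma> ^^ k) \<omega>)\<bar> \<le> U" if "k < n" for k
      proof -
        have "\<bar>K ((\<sigma> ^^ k) \<omega>)\<bar> \<le> G1 \<omega> * (real k + 1) powr u" using K_le[of k] by simp
        also have "\<dots> \<le> (1 + G1 \<omega>) * real n powr u"
          using that uv G1(2)[of \<omega>] by (intro mult_mono powr_mono2) auto
        finally show ?thesis by (simp add: U_def)
      qed
      have \<Phi>_V: "1 + \<Phi> ((\<sigma> ^^ k) \<omega>) \<le> V" if "k < n" for k
      proof -
        have "\<Phi> ((\<sigma> ^^ k) \<omega>) \<le> G2 \<omega> * (real k + 1) powr v" using \<Phi>_le[of k] by simp
        also have "\<dots> \<le> G2 \<omega> * real n powr v"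
          using that uv G2(2)[of \<omega>] by (intro mult_mono powr_mono2) auto
        finally show ?thesis using powr_ge_1 by (simp add: V_def distrib_right)
      qed
      have "Lp_norm (\<mu> ((\<sigma> ^^ 0) \<omega>)) s (\<lambda>x. \<Sum>j<n. f j (cocycle Suc (\<lambda>k. T ((\<sigma> ^^ k) \<omega>)) j 0 x))
          \<le> 3 * moment_const s * sqrt n * (1 + 2 * A) * (2 * (U * V))"
      proof (rule birkhoff_moment[OF f_bounds(1) s, where a = a])
        show "Lp_norm (\<mu> ((\<sigma> ^^ k) \<omega>)) s (f k) \<le> 2 * (U * V)" if "k < n" for k
        proof -
          have "Lp_norm (\<mu> ((\<sigma> ^^ k) \<omega>)) s (f k) \<le> V"
            using f_bounds(2)[of k] \<Phi>_V[OF that] by linarith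
          also have "\<dots> \<le> 2 * U * V" using U1 V1 by simp
          finally show ?thesis by simp
        qed
        show "Lp_norm (\<mu> ((\<sigma> ^^ (j + k)) \<omega>)) s (cocycle Suc (\<lambda>k. L ((\<sigma> ^^ k) \<omega>)) j k (f k))
            \<le> a j * (2 * (U * V))" if "k < n" for j k
        proof -
          have "2 * \<bar>K ((\<sigma> ^^ k) \<omega>)\<bar> * a j * (1 + \<Phi> ((\<sigma> ^^ k) \<omega>)) \<le> 2 * U * a j * V"
            using K_U[OF that] \<Phi>_V[OF that] a_pos[of j] U1 f_bounds(3)[of k]
            by (intro mult_mono) auto
          then show ?thesis using f_decay[of j k] by (simp add: mult_ac)
        qed
        show "0 < 2 * (U * V)" using U1 V1 by simp
      qed (use False A \<open>0 \<le> A\<close> in auto)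
      also have "3 * moment_const s * sqrt n * (1 + 2 * A) * (2 * (U * V))
          = Kbar \<omega> * (real n powr (1 / 2) * real n powr u * real n powr v)"
        by (simp add: Kbar_def c_def U_def V_def powr_half_sqrt mult_ac)
      also have "real n powr (1 / 2) * real n powr u * real n powr v
          = real n powr (1 / 2 + enn2real (1 / p) + enn2real (1 / r) + \<delta>)"
        by (simp add: powr_add[symmetric] u_def v_def \<epsilon>_def add_ac)
      finally show ?thesis by (simp add: birkhoff)
    qed
    ultimately show ?case by blast
  qed
  ultimately show "\<exists>Kbar. in_Lp P \<rho> Kbar \<and>
           (AE \<omega> in P. \<forall>n. in_Lp (\<mu> \<omega>) (ennreal s) (birkhoff_sum \<sigma> T \<phi> n \<omega>) \<and>
              Lp_norm (\<mu> \<omega>) s (birkhoff_sum \<sigma> T \<phi> n \<omega>)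
                \<le> Kbar \<omega> * real n powr (1 / 2 + enn2real (1 / p) + enn2real (1 / r) + \<delta>))"
    by blast
qed

end
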